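(* For every $\gamma\in(1,3]$ and $m\in\{1,2\}$ there exist $P_*\in\{P_6,P_8\}$ and $z_{std}\in\mathcal Z(\gamma;P_* )$ such that $C(V_1;\gamma,z_{std},P_* )=C_1$, i.e., the local analytic solution through $P_*$ extends smoothly to the left to connect $P_*$ with $P_1=(V_1,C_1)$.
   Context: Fix $m\in\{1,2\}$, $\gamma\in(1,3]$. For $z>0$ put $\lambda=1+m\gamma z$, $a_1=1+\frac{m(\gamma-1)}{2}$, $a_2=\frac{m(\gamma-1)+mz\gamma(\gamma-3)}{2}$, $a_3=\frac{mz\gamma(\gamma-1)}{2}$, $G(V,C;\gamma,z)=C^2[(m+1)V+2mz]-V(1+V)(\lambda+V)$, $F(V,C;\gamma,z)=C\{C^2[1+\frac{mz}{1+V}]-a_1(1+V)^2+a_2(1+V)-a_3\}$; ODE $\frac{dC}{dV}=\frac FG$. $V_1=-\frac2{\gamma+1}$, $C_1=\frac{\sqrt{2\gamma(\gamma-1)}}{\gamma+1}$. $z_M=(\sqrt\gamma+\sqrt2)^{-2}$, $z_m=\frac{\gamma-1}{(2\gamma-1)(\gamma+1)}$; for $z\in(0,z_M]$, $w(z)=\sqrt{1-2(\gamma+2)z+(\gamma-2)^2z^2}$, $V_6=\frac{-1+(\gamma-2)z-w}{2}$, $C_6=1+V_6$, $V_8=\frac{-1+(\gamma-2)z+w}{2}$, $C_8=1+V_8$, $P_6=(V_6,C_6)$, $P_8=(V_8,C_8)$. $\mathcal Z(\gamma;P_6)=[z_m,z_M]$, $\mathcal Z(\gamma;P_8)=(0,z_M]$.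 For $P_*=(V_*,C_* )\in\{P_6,P_8\}$ and $z\in\mathcal Z(\gamma;P_* )$, $C(\cdot;\gamma,z,P_* ):[V_1,V_*]\to(0,\infty)$ denotes the unique real-analytic solution of the ODE near $V_*$ with $C(V_* )=C_*$ and $C'(V_* )=c_1$, where $c_1$ is the unique negative root of $-G_Cc^2+(F_C-G_V)c+F_V=0$ (partials at $P_*$), continued as a solution of the ODE to $[V_1,V_*]$. *)

theory Defs
  imports "HOL-Analysis.Analysis"
begin

definition lam :: "real \<Rightarrow> real \<Rightarrow> real \<Rightarrow> real" where
  "lam m g z = 1 + m * g * z"

definition a1 :: "real \<Rightarrow> real \<Rightarrow> real" where
  "a1 m g = 1 + m * (g - 1) / 2"

definition a2 :: "real \<Rightarrow> real \<Rightarrow> real \<Rightarrow> real" where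
  "a2 m g z = (m * (g - 1) + m * z * g * (g - 3)) / 2"

definition a3 :: "real \<Rightarrow> real \<Rightarrow> real \<Rightarrow> real" where
  "a3 m g z = m * z * g * (g - 1) / 2"

definition Gf :: "real \<Rightarrow> real \<Rightarrow> real \<Rightarrow> real \<Rightarrow> real \<Rightarrow> real" where
  "Gf m g z V C = C^2 * ((m + 1) * V + 2 * m * z) - V * (1 + V) * (lam m g z + V)"

definition Ff :: "real \<Rightarrow> real \<Rightarrow> real \<Rightarrow> real \<Rightarrow> real \<Rightarrow> real" where
  "Ff m g z V C = C * (C^2 * (1 + m * z / (1 + V)) - a1 m g * (1 + V)^2
                       + a2 m g z * (1 + V) - a3 m g z)"

definition V1 :: "real \<Rightarrow> real" where
  "V1 g = - 2 / (g + 1)"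

definition C1 :: "real \<Rightarrow> real" where
  "C1 g = sqrt (2 * g * (g - 1)) / (g + 1)"

definition zM :: "real \<Rightarrow> real" where
  "zM g = 1 / (sqrt g + sqrt 2)^2"

definition zm :: "real \<Rightarrow> real" where
  "zm g = (g - 1) / ((2 * g - 1) * (g + 1))"

definition wf :: "real \<Rightarrow> real \<Rightarrow> real" where
  "wf g z = sqrt (1 - 2 * (g + 2) * z + (g - 2)^2 * z^2)"

definition V6 :: "real \<Rightarrow> real \<Rightarrow> real" where
  "V6 g z = (-1 + (g - 2) * z - wf g z) / 2"

definition V8 :: "real \<Rightarrow> real \<Rightarrow> real" where
  "V8 g z = (-1 + (g - 2) * z + wf g z) / 2"

definition P6 :: "real \<Rightarrow> real \<Rightarrow> real \<times> real" where
  "P6 g z = (V6 g z, 1 + V6 g z)"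

definition P8 :: "real \<Rightarrow> real \<Rightarrow> real \<times> real" where
  "P8 g z = (V8 g z, 1 + V8 g z)"

text \<open>The admissible z-ranges: Z(gamma;P6) = [zm,zM], Z(gamma;P8) = (0,zM].
  The point is encoded by an index k \<in> {6,8}.\<close>

definition Zset :: "nat \<Rightarrow> real \<Rightarrow> real set" where
  "Zset k g = (if k = 6 then {zm g .. zM g} else {0 <.. zM g})"

definition Pstar :: "nat \<Rightarrow> real \<Rightarrow> real \<Rightarrow> real \<times> real" where
  "Pstar k g z = (if k = 6 then P6 g z else P8 g z)"

text \<open>The quadratic whose unique negative root gives the slope c1 at P_*,
  with the partial derivatives of F and G taken at P_* = (Vs, Cs).\<close>

definition slope_quad :: "real \<Rightarrow> real \<Rightarrow> real \<Rightarrow> real \<Rightarrow> real \<Rightarrow> real \<Rightarrow> real" where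
  "slope_quad m g z Vs Cs c =
     - deriv (\<lambda>C. Gf m g z Vs C) Cs * c^2
     + (deriv (\<lambda>C. Ff m g z Vs C) Cs - deriv (\<lambda>V. Gf m g z V Cs) Vs) * c
     + deriv (\<lambda>V. Ff m g z V Cs) Vs"

definition Csol :: "real \<Rightarrow> real \<Rightarrow> real \<Rightarrow> real \<Rightarrow> real \<Rightarrow> (real \<Rightarrow> real) \<Rightarrow> bool" where
  "Csol m g z Vs Cs C \<longleftrightarrow>
     V1 g < Vs \<and>
     (\<exists>a :: nat \<Rightarrow> real. \<exists>r > 0.
        (\<forall>V. Vs - r < V \<and> V \<le> Vs \<longrightarrow> (\<lambda>n. a n * (V - Vs)^n) sums C V)
        \<and> a 0 = Cs
        \<and> a 1 < 0 \<and> slope_quad m g z Vs Cs (a 1) = 0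
        \<and> (\<forall>c. c < 0 \<and> slope_quad m g z Vs Cs c = 0 \<longrightarrow> c = a 1))
     \<and> (\<forall>V \<in> {V1 g .. Vs}. C V > 0)
     \<and> (\<forall>V \<in> {V1 g ..< Vs}. Gf m g z V (C V) \<noteq> 0 \<and>
          (C has_real_derivative (Ff m g z V (C V) / Gf m g z V (C V)))
             (at V within {V1 g .. Vs}))"

end

(* With u = 1 + V and C = u sqrt (1 + R) the sonic points become (u, R) = (p, 0), and the parameter
   p in (u1, 1) sweeps both branches P6 and P8 at once. For fixed p the analytic solution through the
   sonic point is a power series in t = u / p - 1 whose coefficients depend continuously on p. It is
   continued to the left as a solution of an equation with clamped right-hand side, so that R(u1)
   is a continuous function of p. As long as R(u1) <= R1 the clamps are inactive: R = R1 cannot be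
   crossed back, and C > p is preserved, which keeps the denominator away from 0. As p tends to u1
   the interval shrinks and R(u1) < R1; as p tends to 1 the solution becomes steep and R(u1) > R1.
   The intermediate value theorem yields the connecting solution. *)

theory Submission
  imports Defs "HOL-Complex_Analysis.Complex_Analysis"
begin

text \<open>At the sonic point F / G is 0 / 0, so initial value theory says nothing there. Writing R
  = t (\<open>ss p\<close> + t w) gives a singular equation for w whose indices U(0) + n V(0) are
  positive; its series converge with a radius uniform in p, and ordinary Picard iteration can start
  at the same relative distance e from every sonic point. The intermediate value theorem needs R(u1)
  for a whole interval of p, also where the unmodified solution might blow up or meet G = 0. This is
  the reason for the clamps: only the values R(u1) \<le> R1 have to be genuine. The parameter p is
  preferred to z because it passes smoothly through the double root z = zM, where w(z) has a square
  root singularity. One inequality, \<open>bracket_pos\<close>, has two uses: it makes C = p a curve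
  that is crossed in one direction only, and it places the slope \<open>ss p\<close> of R below -2,
  which is the condition C' < 0. Steepness as p tends to 1 is measured against the curve p - u = L R
  (1 + R) with L^2 = 4 (1 - p).\<close>

section \<open>Picard iteration with a parameter\<close>

text \<open>The solution is the fixed point of a contraction on bounded continuous functions of
  \<open>(p, s)\<close> jointly, so continuity in the parameter is built in. The weight
  \<open>exp (- 2 * L * s)\<close> makes the contraction factor 1/2 on the whole time interval,
  without subdivision.\<close>

lemma parametric_picard:
  fixes f :: "real \<Rightarrow> real \<Rightarrow> real \<Rightarrow> real" and x0 :: "real \<Rightarrow> real"
  assumes ab: "a \<le> b"
    and contf: "continuous_on ({a..b} \<times> {0..1} \<times> UNIV) (\<lambda>(p, s, x). f p s x)"
    and lip: "\<And>p s x y. p \<in> {a..b} \<Longrightarrow> s \<in> {0..1} \<Longrightarrow> \<bar>f p s x - f p s y\<bar> \<le> L * \<bar>x - y\<bar>"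
    and bnd: "\<And>p s x. p \<in> {a..b} \<Longrightarrow> s \<in> {0..1} \<Longrightarrow> \<bar>f p s x\<bar> \<le> B"
    and contx0: "continuous_on {a..b} x0" and L: "L > 0"
  obtains X where "continuous_on {a..b} (\<lambda>p. X p 1)"
    and "\<And>p. p \<in> {a..b} \<Longrightarrow> X p 0 = x0 p"
    and "\<And>p s. p \<in> {a..b} \<Longrightarrow> s \<in> {0..1} \<Longrightarrow>
           (X p has_real_derivative f p s (X p s)) (at s within {0..1})"
proof -
  \<comment> \<open>The function space consists of functions on the whole plane, so both variables
    are clamped to their ranges before \<open>f\<close> and \<open>x0\<close> are evaluated.\<close>
  define cp where "cp p = max a (min b p)" for p :: real
  define cs where "cs s = max 0 (min 1 s)" for s :: real
  have cp: "cp p \<in> {a..b}" for p using ab by (auto simp: cp_def)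
  have cs: "cs s \<in> {0..1}" for s by (auto simp: cs_def)
  have cp_id: "p \<in> {a..b} \<Longrightarrow> cp p = p" for p by (auto simp: cp_def)
  have cs_id: "s \<in> {0..1} \<Longrightarrow> cs s = s" for s by (auto simp: cs_def)
  have contcp [continuous_intros]: "continuous_on S (\<lambda>x. cp (q x))" if "continuous_on S q" for S and q :: "'z::topological_space \<Rightarrow> real"
    unfolding cp_def by (intro continuous_intros that)
  have contcs [continuous_intros]: "continuous_on S (\<lambda>x. cs (q x))" if "continuous_on S q" for S and q :: "'z::topological_space \<Rightarrow> real"
    unfolding cs_def by (intro continuous_intros that)
  \<comment> \<open>The integral from 0 to s is moved to the fixed interval [0,1] by the
    substitution s v, which makes it a parameter integral, continuous in \<open>(p, s)\<close>. The
    exponential undoes the weight.\<close>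
  define j where "j X p s v = f (cp p) (cs s * v) (exp (2 * L * (cs s * v)) * X (p, cs s * v))"
    for X :: "real \<times> real \<Rightarrow> real" and p s v
  define psi where "psi X = (\<lambda>(p, s). exp (- 2 * L * cs s) *
      (x0 (cp p) + cs s * integral (cbox 0 1) (j X p s)))" for X
  have mem: "cs s * v \<in> {0..1}" if "v \<in> {0..1}" for s v
    using that cs[of s] by (auto intro: mult_le_one)
  have contj: "continuous_on (UNIV \<times> cbox 0 1) (\<lambda>(w, v). j X (fst w) (snd w) v)"
    if X: "continuous_on UNIV X" for X :: "real \<times> real \<Rightarrow> real"
  proof -
    have cX: "continuous_on S (\<lambda>w. X (q w))" if "continuous_on S q" for S and q :: "(real \<times> real) \<times> real \<Rightarrow> real \<times> real"
      using continuous_on_compose2[OF X that] by simp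
    have "continuous_on (UNIV \<times> cbox 0 1) (\<lambda>w. (\<lambda>(p, s, x). f p s x)
       (cp (fst (fst w)), cs (snd (fst w)) * snd w, exp (2 * L * (cs (snd (fst w)) * snd w)) * X (fst (fst w), cs (snd (fst w)) * snd w)))"
      by (rule continuous_on_compose2[OF contf])
        (use cp mem in \<open>auto intro!: continuous_intros cX\<close>)
    then show ?thesis by (simp add: j_def case_prod_beta)
  qed
  have intj: "(j X p s) integrable_on cbox 0 1" and contj1: "continuous_on (cbox 0 1) (j X p s)"
    if X: "continuous_on UNIV X" for X :: "real \<times> real \<Rightarrow> real" and p s
  proof -
    have "continuous_on (cbox 0 1) (\<lambda>v. (\<lambda>(w, v). j X (fst w) (snd w) v) ((p, s), v))"
      by (rule continuous_on_compose2[OF contj[OF X]]) (auto intro!: continuous_intros)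
    then show "continuous_on (cbox 0 1) (j X p s)" by simp
    then show "(j X p s) integrable_on cbox 0 1" by (rule integrable_continuous)
  qed
  have contpsi: "continuous_on UNIV (psi X)" if X: "continuous_on UNIV X" for X
  proof -
    have 1: "continuous_on UNIV (\<lambda>w. integral (cbox 0 1) (j X (fst w) (snd w)))"
      by (rule integral_continuous_on_param) (rule contj[OF X])
    have 2: "continuous_on UNIV (\<lambda>w::real\<times>real. x0 (cp (fst w)))"
      by (rule continuous_on_compose2[OF contx0]) (use cp in \<open>auto intro!: continuous_intros\<close>)
    show ?thesis unfolding psi_def case_prod_beta
      by (intro continuous_intros 1 2)
  qed
  obtain B0 where B0: "\<And>p. p \<in> {a..b} \<Longrightarrow> \<bar>x0 p\<bar> \<le> B0"
    using compact_imp_bounded[OF compact_continuous_image[OF contx0 compact_Icc]]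
    by (force simp: bounded_iff)
  have jb: "\<bar>integral (cbox 0 1) (j X p s)\<bar> \<le> B" if X: "continuous_on UNIV X" for X p s
  proof -
    have "norm (integral (cbox 0 1) (j X p s)) \<le> B * measure lborel (cbox 0 (1::real))"
      by (rule integrable_bound[OF _ intj[OF X]])
         (use bnd[OF cp mem] order_trans[OF abs_ge_zero bnd[OF cp cs]] in \<open>auto simp: j_def\<close>)
    then show ?thesis by simp
  qed
  have psib: "psi X \<in> bcontfun" if X: "continuous_on UNIV X" for X
  proof (rule bcontfun_normI[OF contpsi[OF X]])
    fix w :: "real \<times> real"
    obtain p s where w: "w = (p, s)" by force
    have "\<bar>x0 (cp p) + cs s * integral (cbox 0 1) (j X p s)\<bar> \<le> \<bar>x0 (cp p)\<bar> + \<bar>cs s\<bar> * \<bar>integral (cbox 0 1) (j X p s)\<bar>"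
      by (metis abs_mult abs_triangle_ineq)
    also have "\<dots> \<le> B0 + 1 * B"
      by (intro add_mono mult_mono B0 cp jb X) (use cs[of s] in auto)
    finally have 1: "\<bar>x0 (cp p) + cs s * integral (cbox 0 1) (j X p s)\<bar> \<le> B0 + B" by simp
    have "norm (psi X w) = exp (- 2 * L * cs s) * \<bar>x0 (cp p) + cs s * integral (cbox 0 1) (j X p s)\<bar>"
      by (simp add: psi_def w abs_mult)
    also have "\<dots> \<le> 1 * (B0 + B)"
      by (intro mult_mono 1) (use cs[of s] L in auto)
    finally show "norm (psi X w) \<le> B0 + B" by simp
  qed
  define Phi where "Phi X = Bcontfun (psi (apply_bcontfun X))" for X
  have Phi: "apply_bcontfun (Phi X) = psi (apply_bcontfun X)" for X
    unfolding Phi_def by (rule Bcontfun_inverse, rule psib, rule continuous_on_apply_bcontfun) 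
  have contr: "dist (Phi X) (Phi Y) \<le> 1/2 * dist X Y" for X Y
  proof (rule dist_bound)
    fix w :: "real \<times> real"
    obtain p s where w: "w = (p, s)" by force
    let ?D = "dist X Y" and ?X = "apply_bcontfun X" and ?Y = "apply_bcontfun Y"
    have cX: "continuous_on UNIV ?X" "continuous_on UNIV ?Y" by (auto intro: continuous_on_apply_bcontfun)
    \<comment> \<open>The weight integrates exactly to (exp (2 L s) - 1) / 2; multiplied by exp (- 2
      L s) this stays below 1/2.\<close>
    have eint: "((\<lambda>v. cs s * (L * exp (2 * L * (cs s * v)))) has_integral
        exp (2 * L * (cs s * 1)) / 2 - exp (2 * L * (cs s * 0)) / 2) {0..1}"
      by (rule fundamental_theorem_of_calculus)
         (auto intro!: derivative_eq_intros simp flip: has_real_derivative_iff_has_vector_derivative)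
    have eint2: "((\<lambda>v. ?D * (cs s * (L * exp (2 * L * (cs s * v))))) has_integral
        ?D * ((exp (2 * L * cs s) - 1) / 2)) (cbox 0 1)"
      using has_integral_mult_right[OF eint, of ?D] by (simp add: diff_divide_distrib)
    have intd: "(\<lambda>v. cs s * (j ?X p s v - j ?Y p s v)) integrable_on cbox 0 1"
      by (intro integrable_continuous continuous_intros contj1 cX)
    have "\<bar>cs s * (integral (cbox 0 1) (j ?X p s) - integral (cbox 0 1) (j ?Y p s))\<bar> =
       norm (integral (cbox 0 1) (\<lambda>v. cs s * (j ?X p s v - j ?Y p s v)))"
      using intj[OF cX(1), of p s] intj[OF cX(2), of p s]
      by (simp add: Henstock_Kurzweil_Integration.integral_diff)
    also have "\<dots> \<le> integral (cbox 0 1) (\<lambda>v. ?D * (cs s * (L * exp (2 * L * (cs s * v)))))"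
    proof (rule integral_norm_bound_integral[OF intd has_integral_integrable[OF eint2]])
      fix v :: real assume "v \<in> cbox 0 1"
      then have v: "v \<in> {0..1}" by simp
      have "\<bar>j ?X p s v - j ?Y p s v\<bar> \<le> L * \<bar>exp (2 * L * (cs s * v)) * ?X (p, cs s * v) - exp (2 * L * (cs s * v)) * ?Y (p, cs s * v)\<bar>"
        unfolding j_def by (rule lip[OF cp mem[OF v]])
      also have "\<dots> = L * (exp (2 * L * (cs s * v)) * dist (?X (p, cs s * v)) (?Y (p, cs s * v)))"
        by (simp add: dist_real_def abs_mult flip: right_diff_distrib)
      also have "\<dots> \<le> L * (exp (2 * L * (cs s * v)) * ?D)"
        using L by (intro mult_left_mono dist_bounded) auto
      finally have "cs s * \<bar>j ?X p s v - j ?Y p s v\<bar> \<le> cs s * (L * (exp (2 * L * (cs s * v)) * ?D))"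
        using cs[of s] by (intro mult_left_mono) auto
      then show "norm (cs s * (j ?X p s v - j ?Y p s v)) \<le> ?D * (cs s * (L * exp (2 * L * (cs s * v))))"
        using cs[of s] by (simp add: abs_mult mult_ac)
    qed
    also have "\<dots> = ?D * ((exp (2 * L * cs s) - 1) / 2)" using eint2 by (rule integral_unique)
    finally have I: "\<bar>cs s * (integral (cbox 0 1) (j ?X p s) - integral (cbox 0 1) (j ?Y p s))\<bar> \<le> ?D * ((exp (2 * L * cs s) - 1) / 2)" .
    have "dist (psi ?X w) (psi ?Y w) = exp (- 2 * L * cs s) * \<bar>cs s * (integral (cbox 0 1) (j ?X p s) - integral (cbox 0 1) (j ?Y p s))\<bar>"
      by (simp add: psi_def w dist_real_def abs_mult flip: right_diff_distrib)
    also have "\<dots> \<le> exp (- 2 * L * cs s) * (?D * ((exp (2 * L * cs s) - 1) / 2))"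
      using I by (intro mult_left_mono) auto
    also have "\<dots> = ?D * ((1 - exp (- 2 * L * cs s)) / 2)"
      by (simp add: field_simps exp_minus)
    also have "\<dots> \<le> ?D * (1/2)" by (intro mult_left_mono) auto
    finally show "dist (apply_bcontfun (Phi X) w) (apply_bcontfun (Phi Y) w) \<le> 1/2 * ?D"
      by (simp add: Phi)
  qed
  have "\<exists>!X. Phi X = X" by (rule banach_fix_type[of "1/2"]) (use contr in auto)
  then obtain Y where Y: "Phi Y = Y" by blast
  let ?Y = "apply_bcontfun Y"
  have cY: "continuous_on UNIV ?Y" by (rule continuous_on_apply_bcontfun)
  have Yeq: "?Y (p, s) = exp (- 2 * L * s) * (x0 p + s * integral (cbox 0 1) (j ?Y p s))"
    if "p \<in> {a..b}" "s \<in> {0..1}" for p s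
    using fun_cong[OF Phi[of Y], of "(p, s)"] that by (simp add: Y psi_def cp_id cs_id)
  define X where "X p s = exp (2 * L * s) * ?Y (p, s)" for p s
  have Xeq: "X p s = x0 p + s * integral (cbox 0 1) (j ?Y p s)" if "p \<in> {a..b}" "s \<in> {0..1}" for p s
    by (simp add: X_def Yeq[OF that] exp_minus)
  show ?thesis
  proof (rule that[of X])
    have "continuous_on {a..b} (\<lambda>p. ?Y (p, 1))"
      by (rule continuous_on_compose2[OF cY]) (auto intro!: continuous_intros)
    then show "continuous_on {a..b} (\<lambda>p. X p 1)"
      unfolding X_def by (intro continuous_intros)
  next
    fix p assume "p \<in> {a..b}" then show "X p 0 = x0 p" using Xeq[of p 0] by simp
  next
    fix p s :: real assume p: "p \<in> {a..b}" and s: "s \<in> {0..1}"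
    define k where "k \<sigma> = f p \<sigma> (X p \<sigma>)" for \<sigma>
    have jk: "j ?Y p s v = k (s * v)" if "s \<in> {0..1}" for s v
      by (simp add: j_def k_def X_def cp_id[OF p] cs_id[OF that])
    have contk: "continuous_on {0..1} k"
      using contj1[OF cY, of p 1] jk[of 1] by (simp cong: continuous_on_cong)
    define K where "K s = integral {0..s} k" for s
    have K: "(K has_real_derivative k s) (at s within {0..1})" if "s \<in> {0..1}" for s
      unfolding K_def has_real_derivative_iff_has_vector_derivative
      by (rule integral_has_vector_derivative[OF contk that])
    have XK: "X p s = x0 p + K s" if s: "s \<in> {0..1}" for s
    proof -
      have "((\<lambda>v. s * k (s * v)) has_integral K (s * 1) - K (s * 0)) {0..1}"
      proof (rule fundamental_theorem_of_calculus)
        fix v :: real assume v: "v \<in> {0..1}"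
        have sv: "s * v \<in> {0..1}" using mem[OF v, of s] cs_id[OF s] by simp
        have "(*) s ` {0..1} \<subseteq> {0..1}" using mem[of _ s] cs_id[OF s] by auto
        then have "(K has_real_derivative k (s * v)) (at (s * v) within (*) s ` {0..1})"
          using K[OF sv] DERIV_subset by blast
        then have "(K \<circ> (*) s has_real_derivative (k (s * v) * s)) (at v within {0..1})"
          by (rule DERIV_image_chain) (auto intro!: derivative_eq_intros)
        then have "((\<lambda>v. K (s * v)) has_real_derivative (k (s * v) * s)) (at v within {0..1})"
          by (simp add: o_def)
        then show "((\<lambda>v. K (s * v)) has_vector_derivative s * k (s * v)) (at v within {0..1})"
          by (simp add: has_real_derivative_iff_has_vector_derivative mult.commute)
      qed simp
      then have "integral {0..1} (\<lambda>v. s * k (s * v)) = K s"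
        by (subst integral_unique) (auto simp: K_def)
      moreover have "j ?Y p s = (\<lambda>v. k (s * v))" using jk[OF s] by auto
      ultimately show ?thesis using Xeq[OF p s] by simp
    qed
    have "((\<lambda>s. x0 p + K s) has_real_derivative k s) (at s within {0..1})"
      using K[OF s] by (auto intro!: derivative_eq_intros)
    then have "(X p has_real_derivative k s) (at s within {0..1})"
      by (rule has_field_derivative_transform_within[where d = 1]) (use s XK in auto)
    then show "(X p has_real_derivative f p s (X p s)) (at s within {0..1})"
      by (simp add: k_def)
  qed
qed

section \<open>Power series solutions of a singular equation\<close>

text \<open>A truncated weighted l1 norm. Being a finite sum, it can be used inside the induction
  that establishes convergence.\<close>

definition fps_psum :: "real \<Rightarrow> nat \<Rightarrow> real fps \<Rightarrow> real" where
  "fps_psum \<tau> N f = (\<Sum>n\<le>N. \<bar>fps_nth f n\<bar> * \<tau> ^ n)"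

lemma fps_psum_nonneg: "\<tau> \<ge> 0 \<Longrightarrow> 0 \<le> fps_psum \<tau> N f"
  by (auto simp: fps_psum_def intro!: sum_nonneg)

lemma fps_psum_add: "\<tau> \<ge> 0 \<Longrightarrow> fps_psum \<tau> N (f + g) \<le> fps_psum \<tau> N f + fps_psum \<tau> N g"
  unfolding fps_psum_def sum.distrib[symmetric]
  by (intro sum_mono) (auto simp: ring_distribs(2)[symmetric] intro!: mult_right_mono)

text \<open>The weights are multiplicative, and the pairs with i + j \<le> N lie in the square i, j
  \<le> N.\<close>

lemma fps_psum_mult:
  assumes "\<tau> \<ge> 0"
  shows "fps_psum \<tau> N (f * g) \<le> fps_psum \<tau> N f * fps_psum \<tau> N g"
proof -
  let ?a = "\<lambda>i. \<bar>fps_nth f i\<bar> * \<tau> ^ i" and ?b = "\<lambda>i. \<bar>fps_nth g i\<bar> * \<tau> ^ i"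
  have "fps_psum \<tau> N (f * g) \<le> (\<Sum>k\<le>N. \<Sum>i\<le>k. ?a i * ?b (k - i))"
    unfolding fps_psum_def
  proof (rule sum_mono)
    fix k assume "k \<in> {..N}"
    have "\<bar>fps_nth (f * g) k\<bar> \<le> (\<Sum>i\<le>k. \<bar>fps_nth f i\<bar> * \<bar>fps_nth g (k - i)\<bar>)"
      by (simp add: fps_mult_nth atMost_atLeast0 flip: abs_mult)
    then have "\<bar>fps_nth (f * g) k\<bar> * \<tau> ^ k \<le> (\<Sum>i\<le>k. \<bar>fps_nth f i\<bar> * \<bar>fps_nth g (k - i)\<bar>) * \<tau> ^ k"
      using assms by (intro mult_right_mono) auto
    also have "\<dots> = (\<Sum>i\<le>k. ?a i * ?b (k - i))"
      unfolding sum_distrib_right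
    proof (rule sum.cong)
      fix i assume "i \<in> {..k}"
      then have "\<tau> ^ k = \<tau> ^ i * \<tau> ^ (k - i)" by (simp flip: power_add)
      then show "\<bar>fps_nth f i\<bar> * \<bar>fps_nth g (k - i)\<bar> * \<tau> ^ k = ?a i * ?b (k - i)"
        by (simp only: mult_ac)
    qed simp
    finally show "\<bar>fps_nth (f * g) k\<bar> * \<tau> ^ k \<le> (\<Sum>i\<le>k. ?a i * ?b (k - i))" .
  qed
  also have "\<dots> = (\<Sum>(i, j)\<in>{(i, j). i + j \<le> N}. ?a i * ?b j)"
    by (rule sum.triangle_reindex_eq[symmetric])
  also have "\<dots> \<le> (\<Sum>(i, j)\<in>{..N} \<times> {..N}. ?a i * ?b j)"
    using assms by (intro sum_mono2) auto
  also have "\<dots> = fps_psum \<tau> N f * fps_psum \<tau> N g"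
    by (simp add: fps_psum_def sum_product sum.cartesian_product)
  finally show ?thesis .
qed

text \<open>The equation Z + U w + V y + t (D w^2 + K w y) = 0 with y = t w', whose linear part at
  t = 0 multiplies the n-th coefficient of w by U(0) + n V(0).\<close>

definition sing_eq :: "real poly \<Rightarrow> real poly \<Rightarrow> real poly \<Rightarrow> real poly \<Rightarrow> real poly \<Rightarrow> real fps \<Rightarrow> real fps" where
  "sing_eq Z U V D K W = fps_of_poly Z + fps_of_poly U * W + fps_of_poly V * (fps_X * fps_deriv W)
      + fps_X * (fps_of_poly D * (W * W) + fps_of_poly K * (W * (fps_X * fps_deriv W)))"

text \<open>What is left of \<open>sing_eq\<close> when Z and the constant terms of U and V are
  split off and a factor t is taken out. Coefficient n of the equation sees this series only at
  index n - 1.\<close>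

definition sing_rem :: "real poly \<Rightarrow> real poly \<Rightarrow> real poly \<Rightarrow> real poly \<Rightarrow> real fps \<Rightarrow> real fps" where
  "sing_rem U V D K W = fps_of_poly (poly_shift 1 U) * W + fps_of_poly (poly_shift 1 V) * (fps_X * fps_deriv W)
      + fps_of_poly D * (W * W) + fps_of_poly K * (W * (fps_X * fps_deriv W))"

lemma nth_fps_X_deriv: "fps_nth (fps_X * fps_deriv W) n = of_nat n * fps_nth W n"
  by (cases n) auto

lemma fps_of_poly_shift1:
  fixes U :: "real poly"
  shows "fps_of_poly U = fps_const (coeff U 0) + fps_X * fps_of_poly (poly_shift 1 U)"
proof (rule fps_ext)
  fix n show "fps_nth (fps_of_poly U) n = fps_nth (fps_const (coeff U 0) + fps_X * fps_of_poly (poly_shift 1 U)) n"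
    by (cases n) (auto simp: fps_of_poly_nth coeff_poly_shift)
qed

lemma nth_sing_eq:
  "fps_nth (sing_eq Z U V D K W) n = coeff Z n + (coeff U 0 + real n * coeff V 0) * fps_nth W n
     + (if n = 0 then 0 else fps_nth (sing_rem U V D K W) (n - 1))"
proof -
  have "sing_eq Z U V D K W = fps_of_poly Z + fps_const (coeff U 0) * W
      + fps_const (coeff V 0) * (fps_X * fps_deriv W) + fps_X * sing_rem U V D K W"
    unfolding sing_eq_def sing_rem_def
    by (subst fps_of_poly_shift1[of U], subst fps_of_poly_shift1[of V]) (simp add: algebra_simps)
  then show ?thesis by (auto simp: nth_fps_X_deriv algebra_simps simp del: fps_mult_fps_X_deriv_shift)
qed

lemma fps_mult_nth_local:
  assumes "\<And>i. i \<le> n \<Longrightarrow> fps_nth f i = fps_nth f' i" "\<And>i. i \<le> n \<Longrightarrow> fps_nth g i = fps_nth g' i" "m \<le> n"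
  shows "fps_nth (f * g) m = fps_nth (f' * g') m"
  using assms by (auto simp: fps_mult_nth intro!: sum.cong)

lemma sing_rem_local:
  assumes "\<And>i. i \<le> n \<Longrightarrow> fps_nth f i = fps_nth g i"
  shows "fps_nth (sing_rem U V D K f) n = fps_nth (sing_rem U V D K g) n"
proof -
  have d: "fps_nth (fps_X * fps_deriv f) i = fps_nth (fps_X * fps_deriv g) i" if "i \<le> n" for i
    using assms[OF that] by (simp only: nth_fps_X_deriv)
  show ?thesis unfolding sing_rem_def fps_add_nth
    by (intro arg_cong2[where f = "(+)"] fps_mult_nth_local[of n] assms d refl order_refl) auto
qed

text \<open>Coefficient n of the equation determines the n-th unknown from the earlier ones, since
  its factor U(0) + n V(0) is not zero; the series is built by well-founded recursion.\<close>

lemma sing_eq_solvable: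
  assumes "\<And>n. coeff U 0 + real n * coeff V 0 \<noteq> 0"
  shows "\<exists>W. sing_eq Z U V D K W = 0"
proof -
  define F where "F w n = - (coeff Z n + (if n = 0 then 0 else fps_nth (sing_rem U V D K (Abs_fps w)) (n - 1)))
     / (coeff U 0 + real n * coeff V 0)" for w n
  have "adm_wf less_than F"
    unfolding adm_wf_def F_def by (auto intro!: sing_rem_local)
  from wfrec_fixpoint[OF wf_less_than this] obtain w where w: "w = F w" by blast
  have "fps_nth (sing_eq Z U V D K (Abs_fps w)) n = 0" for n
  proof -
    have "w n = F w n" using w by simp
    then have "(coeff U 0 + real n * coeff V 0) * w n
       = - (coeff Z n + (if n = 0 then 0 else fps_nth (sing_rem U V D K (Abs_fps w)) (n - 1)))"
      using assms[of n] by (simp add: F_def field_simps)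
    then show ?thesis by (simp add: nth_sing_eq)
  qed
  then show ?thesis by (intro exI[of _ "Abs_fps w"] fps_ext) simp
qed

text \<open>A majorant argument. The factor \<open>n + 1\<close> lets one sum control both W and t
  W', and it is paid for by U(0) + n V(0) \<ge> (n + 1) V(0), which follows from U(0) \<ge>
  V(0).\<close>

lemma sing_eq_bound:
  assumes eq: "sing_eq Z U V D K W = 0" and V0: "coeff V 0 > 0" and U0: "coeff U 0 \<ge> coeff V 0"
    and \<tau>: "0 < \<tau>" "\<tau> \<le> 1" and C: "C > 0"
    and bZ: "\<And>N. fps_psum 1 N (fps_of_poly Z) \<le> C"
    and bU: "\<And>N. fps_psum 1 N (fps_of_poly (poly_shift 1 U)) \<le> C"
    and bV: "\<And>N. fps_psum 1 N (fps_of_poly (poly_shift 1 V)) \<le> C"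
    and bD: "\<And>N. fps_psum 1 N (fps_of_poly D) \<le> C" and bK: "\<And>N. fps_psum 1 N (fps_of_poly K) \<le> C"
    and Y: "2 * C \<le> coeff V 0 * Y" "\<tau> * (2 * Y + 2 * Y\<^sup>2) \<le> 1"
  shows "(\<Sum>n\<le>N. real (n + 1) * \<bar>fps_nth W n\<bar> * \<tau> ^ n) \<le> Y"
proof (induction N rule: less_induct)
  case (less N)
  have le1: "fps_psum \<tau> N f \<le> C" if "\<And>N. fps_psum 1 N f \<le> C" for N f
  proof -
    have "fps_psum \<tau> N f \<le> fps_psum 1 N f" unfolding fps_psum_def
      using \<tau> by (intro sum_mono mult_left_mono) (auto intro: power_le_one)
    then show ?thesis using that[of N] by simp
  qed
  have Y0: "Y > 0" using Y(1) C V0 by (smt (verit, best) zero_less_mult_pos)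
  have rem: "fps_psum \<tau> M (sing_rem U V D K W) \<le> C * Y + C * Y + C * (Y * Y) + C * (Y * Y)" if M: "M < N" for M
  proof -
    have w: "fps_psum \<tau> M W \<le> Y"
    proof -
      have "fps_psum \<tau> M W \<le> (\<Sum>n\<le>M. real (n + 1) * \<bar>fps_nth W n\<bar> * \<tau> ^ n)"
        unfolding fps_psum_def using \<tau> by (intro sum_mono mult_right_mono) (auto simp: algebra_simps)
      with less.IH[OF M] show ?thesis by simp
    qed
    have y: "fps_psum \<tau> M (fps_X * fps_deriv W) \<le> Y"
    proof -
      have "fps_psum \<tau> M (fps_X * fps_deriv W) \<le> (\<Sum>n\<le>M. real (n + 1) * \<bar>fps_nth W n\<bar> * \<tau> ^ n)"
        unfolding fps_psum_def nth_fps_X_deriv using \<tau>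
        by (intro sum_mono mult_right_mono) (auto simp: algebra_simps abs_mult)
      with less.IH[OF M] show ?thesis by simp
    qed
    have m: "fps_psum \<tau> M (f * g) \<le> a * b" if "fps_psum \<tau> M f \<le> a" "fps_psum \<tau> M g \<le> b" for f g a b
      using fps_psum_mult[of \<tau> M f g] that \<tau> fps_psum_nonneg[of \<tau> M f] fps_psum_nonneg[of \<tau> M g]
      by (smt (verit) mult_mono)
    have a: "fps_psum \<tau> M (f + g) \<le> a + b" if "fps_psum \<tau> M f \<le> a" "fps_psum \<tau> M g \<le> b" for f g a b
      using fps_psum_add[of \<tau> M f g] that \<tau> by simp
    show ?thesis unfolding sing_rem_def
      by (intro a m w y le1 bU bV bD bK)
  qed
  have coef: "coeff V 0 * (real (n + 1) * \<bar>fps_nth W n\<bar> * \<tau> ^ n) \<le>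
      \<bar>coeff Z n\<bar> * \<tau> ^ n + (if n = 0 then 0 else \<bar>fps_nth (sing_rem U V D K W) (n - 1)\<bar> * \<tau> ^ n)" for n
  proof -
    have "fps_nth (sing_eq Z U V D K W) n = 0" using eq by simp
    then have e: "(coeff U 0 + real n * coeff V 0) * fps_nth W n
       = - (coeff Z n + (if n = 0 then 0 else fps_nth (sing_rem U V D K W) (n - 1)))"
      by (simp add: nth_sing_eq)
    have "coeff V 0 * real (n + 1) * \<bar>fps_nth W n\<bar> \<le> (coeff U 0 + real n * coeff V 0) * \<bar>fps_nth W n\<bar>"
      using U0 by (intro mult_right_mono) (auto simp: algebra_simps)
    also have "\<dots> = \<bar>(coeff U 0 + real n * coeff V 0) * fps_nth W n\<bar>"
      using U0 V0 by (simp add: abs_mult)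
    also have "\<dots> \<le> \<bar>coeff Z n\<bar> + (if n = 0 then 0 else \<bar>fps_nth (sing_rem U V D K W) (n - 1)\<bar>)"
      unfolding e by auto
    finally have "coeff V 0 * real (n + 1) * \<bar>fps_nth W n\<bar> * \<tau> ^ n \<le>
      (\<bar>coeff Z n\<bar> + (if n = 0 then 0 else \<bar>fps_nth (sing_rem U V D K W) (n - 1)\<bar>)) * \<tau> ^ n"
      using \<tau> by (intro mult_right_mono) auto
    then show ?thesis by (simp add: ring_distribs(2) mult.assoc split: if_splits)
  qed
  \<comment> \<open>The shift of the index by one yields a factor \<open>\<tau>\<close>; its
    smallness absorbs the linear and quadratic terms in \<open>Y\<close> and closes the
    induction.\<close>
  have shift: "(\<Sum>n\<le>N. if n = 0 then 0 else \<bar>fps_nth (sing_rem U V D K W) (n - 1)\<bar> * \<tau> ^ n) \<le> C"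
  proof (cases N)
    case 0 then show ?thesis using C by simp
  next
    case (Suc M)
    have "(\<Sum>n\<le>N. if n = 0 then 0 else \<bar>fps_nth (sing_rem U V D K W) (n - 1)\<bar> * \<tau> ^ n)
       = \<tau> * fps_psum \<tau> M (sing_rem U V D K W)"
      unfolding Suc by (subst sum.atMost_Suc_shift) (simp add: fps_psum_def sum_distrib_left mult_ac)
    also have "\<dots> \<le> \<tau> * (C * Y + C * Y + C * (Y * Y) + C * (Y * Y))"
      using rem[of M] Suc \<tau> by (intro mult_left_mono) auto
    also have "\<dots> = C * (\<tau> * (2 * Y + 2 * Y\<^sup>2))" by (simp add: algebra_simps power2_eq_square)
    also have "\<dots> \<le> C * 1" using C Y(2) by (intro mult_left_mono) auto
    finally show ?thesis by simp
  qed
  have "coeff V 0 * (\<Sum>n\<le>N. real (n + 1) * \<bar>fps_nth W n\<bar> * \<tau> ^ n) \<le>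
      fps_psum \<tau> N (fps_of_poly Z) + (\<Sum>n\<le>N. if n = 0 then 0 else \<bar>fps_nth (sing_rem U V D K W) (n - 1)\<bar> * \<tau> ^ n)"
    unfolding sum_distrib_left fps_psum_def sum.distrib[symmetric]
    by (rule sum_mono) (use coef in simp)
  also have "\<dots> \<le> C + C" by (intro add_mono le1 bZ shift)
  also have "\<dots> \<le> coeff V 0 * Y" using Y(1) by simp
  finally show ?case using V0 by simp
qed

section \<open>Dependence of the series on the parameter\<close>

text \<open>The common degree bound belongs to the notion: continuity of each single coefficient
  would not bound the sum of all of them on a compact set.\<close>

definition cpoly_on :: "real set \<Rightarrow> (real \<Rightarrow> real poly) \<Rightarrow> bool" where
  "cpoly_on S a \<longleftrightarrow> (\<forall>n. continuous_on S (\<lambda>p. coeff (a p) n)) \<and> (\<exists>D. \<forall>p\<in>S. degree (a p) \<le> D)"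

lemma cpoly_on_add: "cpoly_on S a \<Longrightarrow> cpoly_on S b \<Longrightarrow> cpoly_on S (\<lambda>p. a p + b p)"
  unfolding cpoly_on_def
proof (intro conjI allI; (elim conjE exE)?)
  fix D E assume "\<forall>p\<in>S. degree (a p) \<le> D" "\<forall>p\<in>S. degree (b p) \<le> E"
  then show "\<exists>D. \<forall>p\<in>S. degree (a p + b p) \<le> D"
    by (intro exI[of _ "max D E"]) (force intro: degree_add_le)
qed (auto intro!: continuous_intros)

lemma cpoly_on_mult: "cpoly_on S a \<Longrightarrow> cpoly_on S b \<Longrightarrow> cpoly_on S (\<lambda>p. a p * b p)"
  unfolding cpoly_on_def
proof (intro conjI allI; (elim conjE exE)?)
  fix D E assume "\<forall>p\<in>S. degree (a p) \<le> D" "\<forall>p\<in>S. degree (b p) \<le> E"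
  then show "\<exists>D. \<forall>p\<in>S. degree (a p * b p) \<le> D"
    by (intro exI[of _ "D + E"]) (meson add_mono degree_mult_le order_trans)
qed (auto simp: coeff_mult intro!: continuous_intros)

lemma cpoly_on_pCons: "continuous_on S c \<Longrightarrow> cpoly_on S a \<Longrightarrow> cpoly_on S (\<lambda>p. pCons (c p) (a p))"
  unfolding cpoly_on_def
proof (intro conjI allI; (elim conjE exE)?)
  fix D assume "\<forall>p\<in>S. degree (a p) \<le> D"
  then show "\<exists>D. \<forall>p\<in>S. degree (pCons (c p) (a p)) \<le> D"
    by (intro exI[of _ "Suc D"]) (meson Suc_le_mono degree_pCons_le order_trans)
next
  fix n assume "continuous_on S c" "\<forall>n. continuous_on S (\<lambda>p. coeff (a p) n)"
  then show "continuous_on S (\<lambda>p. coeff (pCons (c p) (a p)) n)"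
    by (cases n) auto
qed

lemma cpoly_on_0: "cpoly_on S (\<lambda>p. 0)"
  by (auto simp: cpoly_on_def)

lemma cpoly_on_shift: "cpoly_on S a \<Longrightarrow> cpoly_on S (\<lambda>p. poly_shift k (a p))"
  unfolding cpoly_on_def
proof (intro conjI allI; (elim conjE exE)?)
  fix D assume D: "\<forall>p\<in>S. degree (a p) \<le> D"
  have "degree (poly_shift k (a p)) \<le> D" if "p \<in> S" for p
  proof (rule degree_le, intro allI impI)
    fix i assume "D < i"
    then have "degree (a p) < i + k" using D that by force
    then show "coeff (poly_shift k (a p)) i = 0" by (simp add: coeff_poly_shift coeff_eq_0)
  qed
  then show "\<exists>D. \<forall>p\<in>S. degree (poly_shift k (a p)) \<le> D" by blast
qed (auto simp: coeff_poly_shift)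

lemmas cpoly_on_intros = cpoly_on_add cpoly_on_mult cpoly_on_pCons cpoly_on_0 cpoly_on_shift

lemma cpoly_on_bound:
  assumes "compact S" "cpoly_on S a"
  shows "\<exists>C. \<forall>p\<in>S. \<forall>N. fps_psum 1 N (fps_of_poly (a p)) \<le> C"
proof -
  obtain D where D: "\<And>p. p \<in> S \<Longrightarrow> degree (a p) \<le> D" using assms by (auto simp: cpoly_on_def)
  have c: "continuous_on S (\<lambda>p. \<Sum>n\<le>D. \<bar>coeff (a p) n\<bar>)"
    using assms by (auto simp: cpoly_on_def intro!: continuous_intros)
  obtain C where C: "\<And>p. p \<in> S \<Longrightarrow> (\<Sum>n\<le>D. \<bar>coeff (a p) n\<bar>) \<le> C"
    using compact_imp_bounded[OF compact_continuous_image[OF c assms(1)]]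
    by (force simp: bounded_iff)
  have "fps_psum 1 N (fps_of_poly (a p)) \<le> C" if p: "p \<in> S" for p N
  proof -
    have "(\<Sum>n\<le>N. \<bar>coeff (a p) n\<bar>) \<le> (\<Sum>n\<le>max N D. \<bar>coeff (a p) n\<bar>)"
      by (rule sum_mono2) auto
    also have "\<dots> = (\<Sum>n\<le>D. \<bar>coeff (a p) n\<bar>)"
      by (rule sum.mono_neutral_right) (use D[OF p] in \<open>auto intro!: coeff_eq_0\<close>)
    finally show ?thesis using C[OF p] by (simp add: fps_psum_def)
  qed
  then show ?thesis by blast
qed

text \<open>Compactness gives one positive lower bound for V(0) and one upper bound for all
  coefficients, hence \<open>\<tau>\<close> and \<open>Y\<close> that serve all parameters. By the
  recursion each coefficient is a continuous expression in earlier ones over a nonvanishing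
  denominator.\<close>

lemma singular_ode_family:
  assumes S: "compact S" "S \<noteq> {}"
    and cp: "cpoly_on S Z" "cpoly_on S U" "cpoly_on S V" "cpoly_on S D" "cpoly_on S K"
    and V0: "\<And>p. p \<in> S \<Longrightarrow> coeff (V p) 0 > 0"
    and U0: "\<And>p. p \<in> S \<Longrightarrow> coeff (U p) 0 \<ge> coeff (V p) 0"
  obtains \<tau> Y W where "0 < \<tau>" "\<tau> \<le> 1" "Y > 0"
    "\<And>p. p \<in> S \<Longrightarrow> sing_eq (Z p) (U p) (V p) (D p) (K p) (W p) = 0"
    "\<And>p N. p \<in> S \<Longrightarrow> (\<Sum>n\<le>N. real (n + 1) * \<bar>fps_nth (W p) n\<bar> * \<tau> ^ n) \<le> Y"
    "\<And>n. continuous_on S (\<lambda>p. fps_nth (W p) n)"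
proof -
  obtain p0 where p0: "p0 \<in> S" "\<And>p. p \<in> S \<Longrightarrow> coeff (V p0) 0 \<le> coeff (V p) 0"
    using continuous_attains_inf[OF S, of "\<lambda>p. coeff (V p) 0"] cp(3) by (auto simp: cpoly_on_def)
  define v where "v = coeff (V p0) 0"
  have v: "v > 0" using V0 p0 by (auto simp: v_def)
  obtain C1 where C1: "\<forall>p\<in>S. \<forall>N. fps_psum 1 N (fps_of_poly (Z p)) \<le> C1"
    using cpoly_on_bound[OF S(1) cp(1)] by blast
  obtain C2 where C2: "\<forall>p\<in>S. \<forall>N. fps_psum 1 N (fps_of_poly (poly_shift 1 (U p))) \<le> C2"
    using cpoly_on_bound[OF S(1) cpoly_on_shift[OF cp(2)]] by blast
  obtain C3 where C3: "\<forall>p\<in>S. \<forall>N. fps_psum 1 N (fps_of_poly (poly_shift 1 (V p))) \<le> C3"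
    using cpoly_on_bound[OF S(1) cpoly_on_shift[OF cp(3)]] by blast
  obtain C4 where C4: "\<forall>p\<in>S. \<forall>N. fps_psum 1 N (fps_of_poly (D p)) \<le> C4"
    using cpoly_on_bound[OF S(1) cp(4)] by blast
  obtain C5 where C5: "\<forall>p\<in>S. \<forall>N. fps_psum 1 N (fps_of_poly (K p)) \<le> C5"
    using cpoly_on_bound[OF S(1) cp(5)] by blast
  define C where "C = max 1 (max C1 (max C2 (max C3 (max C4 C5))))"
  have C: "C > 0" "C1 \<le> C" "C2 \<le> C" "C3 \<le> C" "C4 \<le> C" "C5 \<le> C" by (auto simp: C_def)
  define Y where "Y = 2 * C / v"
  have Y: "Y > 0" using C v by (simp add: Y_def)
  define \<tau> where "\<tau> = min 1 (1 / (2 * Y + 2 * Y\<^sup>2))"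
  have \<tau>: "0 < \<tau>" "\<tau> \<le> 1" using Y by (auto simp: \<tau>_def add_pos_pos)
  have \<tau>Y: "\<tau> * (2 * Y + 2 * Y\<^sup>2) \<le> 1"
  proof -
    have "\<tau> * (2 * Y + 2 * Y\<^sup>2) \<le> 1 / (2 * Y + 2 * Y\<^sup>2) * (2 * Y + 2 * Y\<^sup>2)"
      using Y by (intro mult_right_mono) (auto simp: \<tau>_def)
    moreover have "2 * Y + 2 * Y\<^sup>2 \<noteq> 0" using add_pos_pos[of "2 * Y" "2 * Y\<^sup>2"] Y by simp
    ultimately show ?thesis by simp
  qed
  have nz: "coeff (U p) 0 + real n * coeff (V p) 0 \<noteq> 0" if "p \<in> S" for p n
    using V0[OF that] U0[OF that] by (smt (verit) mult_nonneg_nonneg of_nat_0_le_iff)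
  have "\<exists>W. sing_eq (Z p) (U p) (V p) (D p) (K p) W = 0" if "p \<in> S" for p
    by (rule sing_eq_solvable) (rule nz[OF that])
  then obtain W where W: "\<And>p. p \<in> S \<Longrightarrow> sing_eq (Z p) (U p) (V p) (D p) (K p) (W p) = 0"
    by metis
  have bound: "(\<Sum>n\<le>N. real (n + 1) * \<bar>fps_nth (W p) n\<bar> * \<tau> ^ n) \<le> Y" if p: "p \<in> S" for p N
  proof -
    have "v * Y \<le> coeff (V p) 0 * Y" using p0(2)[OF p] Y by (intro mult_right_mono) (auto simp: v_def)
    then have Y2: "2 * C \<le> coeff (V p) 0 * Y" using v by (simp add: Y_def)
    note b = C1[THEN bspec, OF p, THEN spec, THEN order_trans[OF _ C(2)]]
      C2[THEN bspec, OF p, THEN spec, THEN order_trans[OF _ C(3)]]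
      C3[THEN bspec, OF p, THEN spec, THEN order_trans[OF _ C(4)]]
      C4[THEN bspec, OF p, THEN spec, THEN order_trans[OF _ C(5)]]
      C5[THEN bspec, OF p, THEN spec, THEN order_trans[OF _ C(6)]]
    show ?thesis by (rule sing_eq_bound[OF W[OF p] V0[OF p] U0[OF p] \<tau> C(1) b Y2 \<tau>Y])
  qed
  have multc: "continuous_on S (\<lambda>p. fps_nth (f p * h p) n)"
    if "\<And>i. i \<le> n \<Longrightarrow> continuous_on S (\<lambda>p. fps_nth (f p) i)" "\<And>i. i \<le> n \<Longrightarrow> continuous_on S (\<lambda>p. fps_nth (h p) i)"
    for f h :: "real \<Rightarrow> real fps" and n
    using that by (auto simp: fps_mult_nth intro!: continuous_intros)
  have contW: "continuous_on S (\<lambda>p. fps_nth (W p) n)" for n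
  proof (induction n rule: less_induct)
    case (less n)
    have wy: "continuous_on S (\<lambda>p. fps_nth (fps_X * fps_deriv (W p)) i)" if "i < n" for i
      unfolding nth_fps_X_deriv using less.IH[OF that] by (intro continuous_intros)
    have cs: "continuous_on S (\<lambda>p. fps_nth (fps_of_poly (a p)) i)" if "cpoly_on S a" for a i
      using that by (simp add: cpoly_on_def)
    have rem: "continuous_on S (\<lambda>p. fps_nth (sing_rem (U p) (V p) (D p) (K p) (W p)) i)" if i: "i < n" for i
    proof -
      have ww: "continuous_on S (\<lambda>p. fps_nth (W p * W p) j)" if "j \<le> i" for j
        by (rule multc; rule less.IH) (use i that in auto)
      have wwy: "continuous_on S (\<lambda>p. fps_nth (W p * (fps_X * fps_deriv (W p))) j)" if "j \<le> i" for j
        by (rule multc[of j W "\<lambda>p. fps_X * fps_deriv (W p)"]; (rule less.IH | rule wy)) (use i that in auto)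
      have 1: "continuous_on S (\<lambda>p. fps_nth (fps_of_poly (poly_shift 1 (U p)) * W p) i)"
        by (rule multc[where h = W], rule cs, rule cpoly_on_shift, rule cp, rule less.IH) (use i in auto)
      have 2: "continuous_on S (\<lambda>p. fps_nth (fps_of_poly (poly_shift 1 (V p)) * (fps_X * fps_deriv (W p))) i)"
        by (rule multc[where h = "\<lambda>p. fps_X * fps_deriv (W p)"], rule cs, rule cpoly_on_shift, rule cp, rule wy) (use i in auto)
      have 3: "continuous_on S (\<lambda>p. fps_nth (fps_of_poly (D p) * (W p * W p)) i)"
        by (rule multc[where h = "\<lambda>p. W p * W p"], rule cs, rule cp, rule ww)
      have 4: "continuous_on S (\<lambda>p. fps_nth (fps_of_poly (K p) * (W p * (fps_X * fps_deriv (W p)))) i)"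
        by (rule multc[where h = "\<lambda>p. W p * (fps_X * fps_deriv (W p))"], rule cs, rule cp, rule wwy)
      show ?thesis unfolding sing_rem_def fps_add_nth by (intro continuous_on_add 1 2 3 4)
    qed
    have rem': "continuous_on S (\<lambda>p. if n = 0 then 0 else fps_nth (sing_rem (U p) (V p) (D p) (K p) (W p)) (n - 1))"
      using rem[of "n - 1"] by (cases "n = 0") auto
    have "continuous_on S (\<lambda>p. - (coeff (Z p) n + (if n = 0 then 0 else fps_nth (sing_rem (U p) (V p) (D p) (K p) (W p)) (n - 1)))
       / (coeff (U p) 0 + real n * coeff (V p) 0))"
      by (intro continuous_intros rem') (use cp nz in \<open>auto simp: cpoly_on_def\<close>)
    moreover have "fps_nth (W p) n = - (coeff (Z p) n + (if n = 0 then 0 else fps_nth (sing_rem (U p) (V p) (D p) (K p) (W p)) (n - 1)))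
       / (coeff (U p) 0 + real n * coeff (V p) 0)" if p: "p \<in> S" for p
    proof -
      have "fps_nth (sing_eq (Z p) (U p) (V p) (D p) (K p) (W p)) n = 0" using W[OF p] by simp
      then show ?thesis unfolding nth_sing_eq using nz[OF p, of n] by (simp add: field_simps)
    qed
    ultimately show ?case by (simp cong: continuous_on_cong)
  qed
  show ?thesis using that[OF \<tau> Y W bound contW] .
qed

lemma fps_conv_radius_geI_psum:
  assumes b: "\<And>N. (\<Sum>n\<le>N. real (n + 1) * \<bar>fps_nth W n\<bar> * \<tau> ^ n) \<le> Y" and \<tau>: "0 < \<tau>"
  shows "fps_conv_radius W \<ge> \<tau>" and "\<bar>t\<bar> \<le> \<tau> \<Longrightarrow> \<bar>eval_fps W t\<bar> \<le> Y"
    and "\<bar>fps_nth W n\<bar> * \<tau> ^ n \<le> Y"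
proof -
  have b': "(\<Sum>n\<le>N. \<bar>fps_nth W n\<bar> * \<tau> ^ n) \<le> Y" for N
  proof -
    have "(\<Sum>n\<le>N. \<bar>fps_nth W n\<bar> * \<tau> ^ n) \<le> (\<Sum>n\<le>N. real (n + 1) * \<bar>fps_nth W n\<bar> * \<tau> ^ n)"
      using \<tau> by (intro sum_mono mult_right_mono) (auto simp: algebra_simps)
    with b[of N] show ?thesis by simp
  qed
  have s: "summable (\<lambda>n. \<bar>fps_nth W n\<bar> * \<tau> ^ n)"
    by (rule bounded_imp_summable) (use b' \<tau> in auto)
  then have "summable (\<lambda>n. norm (fps_nth W n * \<tau> ^ n))" using \<tau> by (simp add: abs_mult)
  then have "summable (\<lambda>n. fps_nth W n * \<tau> ^ n)" by (rule summable_norm_cancel)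
  from conv_radius_geI[OF this] \<tau> show "fps_conv_radius W \<ge> \<tau>" by (simp add: fps_conv_radius_def)
  have "\<bar>fps_nth W n\<bar> * \<tau> ^ n \<le> (\<Sum>n\<le>n. \<bar>fps_nth W n\<bar> * \<tau> ^ n)"
    using \<tau> by (intro member_le_sum) auto
  with b'[of n] show "\<bar>fps_nth W n\<bar> * \<tau> ^ n \<le> Y" by simp
  assume t: "\<bar>t\<bar> \<le> \<tau>"
  have le: "norm (fps_nth W n * t ^ n) \<le> \<bar>fps_nth W n\<bar> * \<tau> ^ n" for n
    using t by (auto simp: abs_mult power_abs intro!: mult_left_mono power_mono)
  have "norm (eval_fps W t) \<le> (\<Sum>n. \<bar>fps_nth W n\<bar> * \<tau> ^ n)"
    unfolding eval_fps_def by (rule norm_suminf_le[OF le s])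
  also have "\<dots> \<le> Y"
  proof (rule suminf_le_const[OF s])
    fix n
    have "(\<Sum>i<n. \<bar>fps_nth W i\<bar> * \<tau> ^ i) \<le> (\<Sum>i\<le>n. \<bar>fps_nth W i\<bar> * \<tau> ^ i)"
      using \<tau> by (intro sum_mono2) auto
    with b'[of n] show "(\<Sum>i<n. \<bar>fps_nth W i\<bar> * \<tau> ^ i) \<le> Y" by simp
  qed
  finally show "\<bar>eval_fps W t\<bar> \<le> Y" by simp
qed

lemma eval_sing_eq:
  assumes "sing_eq Z U V D K W = 0" and t: "norm t < fps_conv_radius W"
  defines "w \<equiv> eval_fps W t" and "w' \<equiv> eval_fps (fps_deriv W) t"
  shows "poly Z t + poly U t * w + poly V t * (t * w') + t * (poly D t * w\<^sup>2 + poly K t * w * (t * w')) = 0"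
proof -
  have t': "norm t < fps_conv_radius (fps_deriv W)" using t fps_conv_radius_deriv[of W] by (rule less_le_trans)
  have m: "ereal (norm t) < fps_conv_radius (f * h)" "eval_fps (f * h) t = eval_fps f t * eval_fps h t"
    if "norm t < fps_conv_radius f" "norm t < fps_conv_radius h" for f h :: "real fps"
    using that fps_conv_radius_mult[of f h] eval_fps_mult[of t f h] by (auto simp: min_def split: if_splits)
  have a: "ereal (norm t) < fps_conv_radius (f + h)" "eval_fps (f + h) t = eval_fps f t + eval_fps h t"
    if "norm t < fps_conv_radius f" "norm t < fps_conv_radius h" for f h :: "real fps"
    using that fps_conv_radius_add[of f h] eval_fps_add[of t f h] by (auto simp: min_def split: if_splits)
  have i: "ereal (norm t) < fps_conv_radius (fps_of_poly q)" "ereal (norm t) < fps_conv_radius (fps_X :: real fps)" for q :: "real poly"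
    by auto
  have "0 = eval_fps (sing_eq Z U V D K W) t" by (simp add: assms(1))
  also have "\<dots> = poly Z t + poly U t * w + poly V t * (t * w') + t * (poly D t * (w * w) + poly K t * (w * (t * w')))"
    unfolding sing_eq_def w_def w'_def
    by (simp only: a(2) m(2) a(1) m(1) i t t' eval_fps_of_poly eval_fps_X)
  finally show ?thesis by (simp add: power2_eq_square mult_ac)
qed

text \<open>Halving the radius produces the majorant Y / 2^n, which does not depend on p.\<close>

lemma continuous_on_eval_fps_param:
  fixes W :: "real \<Rightarrow> real fps" and Y :: real
  assumes c: "\<And>n. continuous_on S (\<lambda>p. fps_nth (W p) n)" and \<tau>: "\<tau> > 0"
    and b: "\<And>p n. p \<in> S \<Longrightarrow> \<bar>fps_nth (W p) n\<bar> * \<tau> ^ n \<le> Y" and t: "\<bar>t\<bar> \<le> \<tau> / 2"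
  shows "continuous_on S (\<lambda>p. eval_fps (W p) t)"
proof -
  have "uniform_limit S (\<lambda>n p. \<Sum>i<n. fps_nth (W p) i * t ^ i) (\<lambda>p. \<Sum>i. fps_nth (W p) i * t ^ i) sequentially"
  proof (rule Weierstrass_m_test)
    show "summable (\<lambda>n. Y * (1/2::real) ^ n)" by (intro summable_mult summable_geometric) auto
    fix n p assume p: "p \<in> S"
    have "norm (fps_nth (W p) n * t ^ n) \<le> \<bar>fps_nth (W p) n\<bar> * (\<tau> / 2) ^ n"
      using t by (auto simp: abs_mult power_abs intro!: mult_left_mono power_mono)
    also have "\<dots> = \<bar>fps_nth (W p) n\<bar> * \<tau> ^ n * (1/2) ^ n" by (simp add: power_divide)
    also have "\<dots> \<le> Y * (1/2) ^ n" by (intro mult_right_mono b p) auto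
    finally show "norm (fps_nth (W p) n * t ^ n) \<le> Y * (1/2) ^ n" .
  qed
  then show ?thesis
    unfolding eval_fps_def
    by (rule uniform_limit_theorem[rotated]) (auto intro!: always_eventually continuous_intros c)
qed

section \<open>Two analytic tools: one-way crossing and square roots of power series\<close>

text \<open>At the first point where \<open>D\<close> is not positive it vanishes with positive
  derivative, hence is already negative just before. The sign of the derivative at zeros of
  \<open>D\<close> suffices, so a solution can be confined by a curve without further knowledge of
  it.\<close>

lemma barrier:
  fixes D D' :: "real \<Rightarrow> real"
  assumes ab: "a \<le> b" and der: "\<And>s. s \<in> {a..b} \<Longrightarrow> (D has_real_derivative D' s) (at s within {a..b})"
    and pos: "\<And>s. s \<in> {a..b} \<Longrightarrow> D s = 0 \<Longrightarrow> D' s > 0" and D0: "D a > 0" and s: "s \<in> {a..b}"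
  shows "D s > 0"
proof (rule ccontr)
  assume neg: "\<not> D s > 0"
  have cont: "continuous_on {a..b} D"
    unfolding continuous_on_eq_continuous_within by (intro ballI DERIV_continuous[OF der])
  let ?T = "{a..s} \<inter> {x. D x \<le> 0}"
  have cs: "continuous_on {a..s} D" by (rule continuous_on_subset[OF cont]) (use s in auto)
  have "closed ({a..s} \<inter> D -` {..0})"
    by (rule continuous_closed_preimage[OF cs]) auto
  moreover have "{a..s} \<inter> D -` {..0} = ?T" by auto
  ultimately have "closed ?T" by simp
  moreover have "bounded ?T" by (rule bounded_subset[of "{a..s}"]) auto
  ultimately have cl: "compact ?T" by (simp add: compact_eq_bounded_closed)
  have ne: "?T \<noteq> {}" using neg s by auto
  obtain c where c: "c \<in> ?T" "\<And>x. x \<in> ?T \<Longrightarrow> c \<le> x"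
    using compact_attains_inf[OF cl ne] by auto
  have ca: "a < c" using c(1) D0 by (cases "a = c") auto
  have cin: "c \<in> {a..b}" using c s by auto
  have "D c = 0"
  proof (rule ccontr)
    assume "D c \<noteq> 0"
    then have "\<exists>x\<ge>a. x \<le> c \<and> D x = 0"
      using c(1) D0 ca continuous_on_subset[OF cont, of "{a..c}"] cin by (intro IVT2') auto
    then obtain x where "a \<le> x" "x \<le> c" "D x = 0" by blast
    with c(1) c(2)[of x] \<open>D c \<noteq> 0\<close> show False by auto
  qed
  then have "D' c > 0" using pos[OF cin] by auto
  from has_real_derivative_pos_inc_left[OF der[OF cin] this]
  obtain d where d: "d > 0" "\<And>h. 0 < h \<Longrightarrow> c - h \<in> {a..b} \<Longrightarrow> h < d \<Longrightarrow> D (c - h) < D c" by auto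
  define h where "h = min (d / 2) (c - a)"
  have "D (c - h) < D c" by (rule d(2)) (use d ca cin in \<open>auto simp: h_def\<close>)
  then have "c - h \<in> ?T" using c(1) d ca by (auto simp: h_def)
  from c(2)[OF this] show False using d ca by (auto simp: h_def)
qed

text \<open>Analyticity is imported from the complex plane: near 0 the complexified series has
  positive real part, where \<open>csqrt\<close> is holomorphic. The coefficients are real parts of
  Taylor coefficients; the first two follow by comparing value and derivative at 0.\<close>

lemma sqrt_eval_fps_powser:
  fixes f :: "real fps"
  assumes rad: "fps_conv_radius f > 0" and f0: "fps_nth f 0 > 0"
  obtains h r where "r > 0" "\<And>x. \<bar>x\<bar> < r \<Longrightarrow> (\<lambda>n. h n * x ^ n) sums sqrt (eval_fps f x)"
    "h 0 = sqrt (fps_nth f 0)" "h 1 = fps_nth f 1 / (2 * sqrt (fps_nth f 0))"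
proof -
  define fc where "fc = Abs_fps (\<lambda>n. complex_of_real (fps_nth f n))"
  have radc: "fps_conv_radius fc = fps_conv_radius f"
    unfolding fps_conv_radius_def conv_radius_def fc_def by simp
  have evc: "eval_fps fc (of_real x) = of_real (eval_fps f x)" if "ereal \<bar>x\<bar> < fps_conv_radius f" for x
  proof -
    have "(\<lambda>n. fps_nth f n * x ^ n) sums eval_fps f x" by (rule sums_eval_fps) (use that in simp)
    then have "(\<lambda>n. complex_of_real (fps_nth f n * x ^ n)) sums of_real (eval_fps f x)" by (rule sums_of_real)
    then show ?thesis by (simp add: eval_fps_def fc_def sums_iff)
  qed
  obtain R where R: "R > 0" "ereal R < fps_conv_radius f" using ereal_dense2[OF rad] by (auto simp: zero_ereal_def)
  have hol: "eval_fps fc holomorphic_on ball 0 R"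
    by (rule holomorphic_on_eval_fps) (use R in \<open>auto simp: radc eball_def intro: less_trans[of _ "ereal R"]\<close>)
  have "continuous_on (ball 0 R) (eval_fps fc)" by (rule holomorphic_on_imp_continuous_on[OF hol])
  then have "isCont (eval_fps fc) 0" using R by (intro continuous_on_interior[of "ball 0 R"]) auto
  then have "((\<lambda>z. Re (eval_fps fc z)) \<longlongrightarrow> Re (eval_fps fc 0)) (at 0)"
    by (intro tendsto_intros) (simp add: isCont_def)
  moreover have "Re (eval_fps fc 0) > 0" using f0 by (simp add: eval_fps_at_0 fc_def)
  ultimately have "\<forall>\<^sub>F z in at 0. Re (eval_fps fc z) > 0" by (rule order_tendstoD)
  then obtain d where d: "d > 0" "\<And>z. z \<noteq> 0 \<Longrightarrow> dist z 0 < d \<Longrightarrow> Re (eval_fps fc z) > 0"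
    by (auto simp: eventually_at)
  define r where "r = min R d"
  have r: "r > 0" using R d by (auto simp: r_def)
  have pos: "Re (eval_fps fc z) > 0" if "z \<in> ball 0 r" for z
    using d(2)[of z] \<open>Re (eval_fps fc 0) > 0\<close> that by (cases "z = 0") (auto simp: r_def)
  have nn: "eval_fps fc z \<notin> \<real>\<^sub>\<le>\<^sub>0" if "z \<in> ball 0 r" for z
    using pos[OF that] by (simp add: complex_nonpos_Reals_iff)
  define F where "F z = csqrt (eval_fps fc z)" for z
  have holF: "F holomorphic_on ball 0 r" unfolding F_def
    by (rule holomorphic_on_compose_gen[OF holomorphic_on_subset[OF hol] holomorphic_on_csqrt, unfolded o_def])
       (use nn in \<open>auto simp: r_def\<close>)
  define h where "h n = Re ((deriv ^^ n) F 0 / fact n)" for n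
  have ser: "(\<lambda>n. h n * x ^ n) sums sqrt (eval_fps f x)" if x: "\<bar>x\<bar> < r" for x
  proof -
    have "ereal \<bar>x\<bar> < ereal R" using x by (auto simp: r_def)
    then have xR: "ereal \<bar>x\<bar> < fps_conv_radius f" using R(2) by (rule less_trans)
    have "(\<lambda>n. (deriv ^^ n) F 0 / fact n * (of_real x - 0) ^ n) sums F (of_real x)"
      by (rule holomorphic_power_series[OF holF]) (use x in auto)
    then have "(\<lambda>n. Re ((deriv ^^ n) F 0 / fact n * (of_real x - 0) ^ n)) sums Re (F (of_real x))"
      by (rule sums_Re)
    moreover have "Re ((deriv ^^ n) F 0 / fact n * (of_real x - 0) ^ n) = h n * x ^ n" for n
    proof -
      have "Re (c * of_real y) = Re c * y" for c y by simp
      then show ?thesis unfolding h_def diff_0_right of_real_power[symmetric] .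
    qed
    moreover have "Re (F (of_real x)) = sqrt (eval_fps f x)"
    proof -
      have "Re (eval_fps fc (of_real x)) > 0" by (rule pos) (use x in auto)
      then have "eval_fps f x > 0" by (simp add: evc[OF xR])
      then show ?thesis by (simp add: F_def evc[OF xR] flip: of_real_sqrt)
    qed
    ultimately show ?thesis by simp
  qed
  have h0: "h 0 = sqrt (fps_nth f 0)"
    using ser[of 0] r by (simp add: sums_iff eval_fps_at_0)
  define H where "H = Abs_fps h"
  have Hr: "fps_conv_radius H \<ge> r / 2"
    using conv_radius_geI[OF sums_summable[OF ser[of "r / 2"]]] r by (simp add: fps_conv_radius_def H_def)
  have "(eval_fps H has_field_derivative eval_fps (fps_deriv H) 0) (at 0)"
    by (rule has_field_derivative_eval_fps) (use Hr r in \<open>auto simp: zero_ereal_def intro: less_le_trans[rotated]\<close>)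
  then have 1: "(eval_fps H has_field_derivative h 1) (at 0)" by (simp add: eval_fps_at_0 H_def)
  have "(eval_fps f has_field_derivative eval_fps (fps_deriv f) 0) (at 0)"
    by (rule has_field_derivative_eval_fps) (use rad in \<open>auto simp: zero_ereal_def\<close>)
  then have "((\<lambda>x. sqrt (eval_fps f x)) has_field_derivative fps_nth f 1 / (2 * sqrt (fps_nth f 0))) (at 0)"
    using f0 by (auto intro!: derivative_eq_intros simp: eval_fps_at_0 field_simps rad rad[unfolded zero_ereal_def])
  then have 2: "(eval_fps H has_field_derivative fps_nth f 1 / (2 * sqrt (fps_nth f 0))) (at 0)"
    by (rule has_field_derivative_transform_within[OF _ r])
       (use ser in \<open>auto simp: eval_fps_def H_def sums_iff\<close>)
  show ?thesis by (rule that[OF r ser h0 DERIV_unique[OF 1 2]])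
qed

text \<open>The parameter p is the value of u = 1 + V at the sonic point; p runs through both branches:
  zz p is the z for which p solves the quadratic satisfied by 1 + V6 and 1 + V8, and bb p is the
  other root. With C = u sqrt (1 + R) the equation becomes u R' = - 2 (1 + R) N / E.\<close>

locale shock =
  fixes m g :: real
  assumes m: "m = 1 \<or> m = 2" and g1: "1 < g" and g3: "g \<le> 3"
begin

section \<open>Signs of numerator and denominator in the variables u and R\<close>

definition zz :: "real \<Rightarrow> real" where "zz p = p * (1 - p) / (g - (g - 2) * p)"
definition bb :: "real \<Rightarrow> real" where "bb p = g * (1 - p) / (g - (g - 2) * p)"
definition kk :: "real \<Rightarrow> real \<Rightarrow> real" where "kk p u = (m + 1) * (1 - u) - 2 * m * zz p"
definition hh :: "real \<Rightarrow> real \<Rightarrow> real" where "hh p u = m * (1 - u) + 1 - m * zz p"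
definition qq :: "real \<Rightarrow> real \<Rightarrow> real" where "qq p u = m * (u - p) * (u - bb p) / u"
text \<open>The normalisation is such that, for C = u sqrt (1 + R), \<open>Gf\<close> equals - u^2
  \<open>EE\<close> and \<open>Ff\<close> equals C u (\<open>NN\<close> -
  \<open>EE\<close>).\<close>

definition EE :: "real \<Rightarrow> real \<Rightarrow> real \<Rightarrow> real" where "EE p u R = kk p u * R - qq p u"
definition NN :: "real \<Rightarrow> real \<Rightarrow> real \<Rightarrow> real" where "NN p u R = hh p u * R - (g + 1) / 2 * qq p u"
text \<open>\<open>u1\<close> and \<open>R1\<close> are the coordinates of the target point:
  \<open>u1\<close> = 1 + \<open>V1 g\<close>, and \<open>C1 g\<close> = \<open>u1\<close> sqrt (1 +
  \<open>R1\<close>).\<close>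

definition u1 :: real where "u1 = (g - 1) / (g + 1)"
definition R1 :: real where "R1 = (g + 1) / (g - 1)"
text \<open>The line C = p in the new variables.\<close>

definition Rlow :: "real \<Rightarrow> real \<Rightarrow> real" where "Rlow p u = p\<^sup>2 / u\<^sup>2 - 1"

lemma m_bounds: "1 \<le> m" "m \<le> 2" using m by auto

lemma u1_bounds: "0 < u1" "u1 < 1" "u1 \<le> 1/2" using g1 g3 by (auto simp: u1_def field_simps)
lemma R1_pos: "R1 > 0" using g1 by (simp add: R1_def)

lemma den_pos: "0 \<le> p \<Longrightarrow> p \<le> 1 \<Longrightarrow> 0 < g - (g - 2) * p"
proof -
  assume p: "0 \<le> p" "p \<le> 1"
  have "g - (g - 2) * p = g * (1 - p) + 2 * p" by (simp add: algebra_simps)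
  also have "\<dots> > 0" using p g1 by (cases "p = 0") (auto intro!: add_nonneg_pos)
  finally show ?thesis .
qed

text \<open>\<open>p\<close> and \<open>bb p\<close> are the roots of x^2 - (1 + (g - 2) z) x + g z
  with z = \<open>zz p\<close>; later algebra uses their sum and product only. The last bound
  selects the component z \<le> zM of the set where the discriminant is nonnegative.\<close>

lemma zb:
  assumes "0 < p" "p < 1"
  shows "0 < zz p" "0 < bb p" "bb p < 1" "p * bb p = g * zz p" "p + bb p = 1 + (g - 2) * zz p"
    "2 * zz p \<le> 1 - p" "(g + 2) * zz p < 1"
proof -
  have d: "0 < g - (g - 2) * p" using den_pos[of p] assms by simp
  show "0 < zz p" "0 < bb p" "p * bb p = g * zz p" using d assms g1 by (auto simp: zz_def bb_def)
  show "bb p < 1" using d assms by (simp add: bb_def divide_less_eq) (simp add: algebra_simps)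
  show "p + bb p = 1 + (g - 2) * zz p" using d by (simp add: zz_def bb_def divide_simps) (simp add: algebra_simps)
  have "2 * p * (1 - p) \<le> (1 - p) * (g - (g - 2) * p)"
  proof -
    have "(1 - p) * (g - (g - 2) * p) - 2 * p * (1 - p) = (1 - p) * (g * (1 - p))" by (simp add: algebra_simps)
    also have "\<dots> \<ge> 0" using assms g1 by auto
    finally show ?thesis by simp
  qed
  then show "2 * zz p \<le> 1 - p" using d by (simp add: zz_def divide_le_eq mult.assoc)
  have "g - (g - 2) * p - (g + 2) * (p * (1 - p)) = g * (1 - p)\<^sup>2 + 2 * p\<^sup>2"
    by (simp add: algebra_simps power2_eq_square)
  also have "\<dots> > 0" using assms g1 by (intro add_pos_pos) auto
  finally show "(g + 2) * zz p < 1" using d by (simp add: zz_def divide_less_eq)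
qed

text \<open>\<open>bb\<close> is decreasing and g / (2 g - 1) is its value at
  \<open>u1\<close>.\<close>

lemma bb_le:
  assumes "u1 \<le> p" "p < 1"
  shows "bb p \<le> g / (2 * g - 1)"
proof -
  have p: "0 < p" using assms u1_bounds by simp
  have d: "0 < g - (g - 2) * p" using den_pos[of p] assms p by simp
  have "g - 1 \<le> p * (g + 1)" using assms g1 by (simp add: u1_def divide_le_eq)
  then have "g * ((1 - p) * (2 * g - 1)) \<le> g * (g - (g - 2) * p)"
    using g1 by (intro mult_left_mono) (auto simp: algebra_simps)
  then show ?thesis using d g1 by (simp add: bb_def divide_simps mult_ac)
qed

text \<open>On R = \<open>Rlow p u\<close> this bracket is the factor of (p - u) / u in
  \<open>NN\<close> - \<open>EE\<close>, and at u = p it is - \<open>TT p (- 2)\<close> / 2. It is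
  estimated by its worst values, 2 \<open>u1\<close> for the first summand and the largest
  \<open>bb p\<close> in the second.\<close>

lemma bracket_pos:
  assumes p: "u1 \<le> p" "p < 1" and u: "u1 \<le> u" "u \<le> p"
  shows "(u + m * zz p) * (p + u) / u + (g - 1) / 2 * m * (u - bb p) > 0"
proof -
  have p0: "0 < p" "0 < u" using assms u1_bounds by auto
  note z = zb[OF p0(1) p(2)]
  have "(u + m * zz p) * (p + u) / u = p + u + m * zz p * (p + u) / u"
    using p0 by (simp add: field_simps)
  also have "\<dots> \<ge> 2 * u1" using p0 z m_bounds u p by (smt (verit) divide_nonneg_pos mult_nonneg_nonneg)
  finally have 1: "(u + m * zz p) * (p + u) / u \<ge> 2 * u1" .
  have "(g - 1) / 2 * m * (u - bb p) \<ge> (g - 1) / 2 * m * (u1 - g / (2 * g - 1))"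
    using bb_le[OF p] u g1 m_bounds by (intro mult_left_mono) auto
  moreover have "2 * u1 + (g - 1) / 2 * m * (u1 - g / (2 * g - 1)) > 0"
  proof -
    have "2 * u1 + (g - 1) / 2 * m * (u1 - g / (2 * g - 1)) =
       (g - 1) * (4 * (2 * g - 1) + m * ((g - 1) * (2 * g - 1) - g * (g + 1))) / (2 * (g + 1) * (2 * g - 1))"
      using g1 by (simp add: u1_def divide_simps) (simp add: algebra_simps)
    also have "\<dots> > 0"
    proof -
      \<comment> \<open>This equals g^2 + 4 g - 3 for m = 1 and 2 (g^2 - 1) for m = 2.\<close>
      have "4 * (2 * g - 1) + m * ((g - 1) * (2 * g - 1) - g * (g + 1)) > 0"
        using m g1 mult_strict_mono[of 1 g 1 g] by (elim disjE) (auto simp: algebra_simps)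
      then show ?thesis using g1 by (intro divide_pos_pos mult_pos_pos) auto
    qed
    finally show ?thesis .
  qed
  ultimately show ?thesis using 1 by linarith
qed

lemma kk_ge: "0 < p \<Longrightarrow> p < 1 \<Longrightarrow> u \<le> p \<Longrightarrow> kk p u \<ge> 1 - u"
proof -
  assume p: "0 < p" "p < 1" "u \<le> p"
  have "m * (2 * zz p) \<le> m * (1 - u)" using zb(6)[OF p(1,2)] p m_bounds by (intro mult_left_mono) auto
  then show ?thesis by (simp add: kk_def algebra_simps)
qed

lemma hh_ge: "0 < p \<Longrightarrow> p < 1 \<Longrightarrow> u \<le> p \<Longrightarrow> hh p u \<ge> 1"
proof -
  assume p: "0 < p" "p < 1" "u \<le> p"
  have "m * zz p \<le> m * (1 - u)" using zb(1,6)[OF p(1,2)] p m_bounds by (intro mult_left_mono) auto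
  then show ?thesis by (simp add: hh_def algebra_simps)
qed

text \<open>Bounds from below the factor of (p - u) / u in \<open>EE\<close> on C = p, since (p + u)
  / u \<ge> 2 there.\<close>

lemma kk_shift_ge:
  assumes "0 < p" "p < 1" "u \<le> p"
  shows "2 * kk p u + m * (u - bb p) \<ge> 2 * (1 - p)"
proof -
  note z = zb[OF assms(1,2)]
  have "2 * kk p u + m * (u - bb p) - 2 * (1 - p) = (m + 2) * (p - u) + m * (1 - (g + 2) * zz p)"
    using z(5) unfolding kk_def by algebra
  also have "\<dots> \<ge> 0" using assms z m_bounds by (intro add_nonneg_nonneg mult_nonneg_nonneg) auto
  finally show ?thesis by simp
qed

lemma EE_Rlow_ge:
  assumes "u1 \<le> u" "u \<le> p" "p < 1"
  shows "EE p u (Rlow p u) \<ge> (p - u) * (2 * (1 - p))"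
proof -
  have p: "0 < p" "0 < u" using assms u1_bounds by auto
  have "EE p u (Rlow p u) = (p - u) / u * (kk p u * ((p + u) / u) + m * (u - bb p))"
    unfolding EE_def Rlow_def qq_def using p by (simp add: divide_simps) (simp add: power2_eq_square algebra_simps)
  also have "\<dots> \<ge> (p - u) / u * (2 * (1 - p))"
  proof (intro mult_left_mono)
    have "2 \<le> (p + u) / u" using p assms by (simp add: field_simps)
    then have "kk p u * 2 \<le> kk p u * ((p + u) / u)"
      using kk_ge[OF p(1) assms(3,2)] assms by (intro mult_left_mono) auto
    then show "2 * (1 - p) \<le> kk p u * ((p + u) / u) + m * (u - bb p)"
      using kk_shift_ge[OF p(1) assms(3,2)] by simp
  qed (use assms p in auto)
  also have "(p - u) / u * (2 * (1 - p)) \<ge> (p - u) * (2 * (1 - p))"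
  proof (intro mult_right_mono)
    have "(p - u) * u \<le> p - u" using assms p by (intro mult_left_le) auto
    then show "p - u \<le> (p - u) / u" using p by (simp add: le_divide_eq)
  qed (use assms in auto)
  finally show ?thesis by simp
qed

text \<open>\<open>EE\<close> is increasing in \<open>R\<close>, so the bound on the line C = p
  holds everywhere above it. The bound degenerates only as u tends to p or p tends to 1.\<close>

lemma EE_pos:
  assumes "u1 \<le> u" "u < p" "p < 1" "Rlow p u \<le> R"
  shows "EE p u R \<ge> (p - u) * (2 * (1 - p))" "EE p u R > 0"
proof -
  have p: "0 < p" using assms u1_bounds by auto
  have "kk p u * Rlow p u \<le> kk p u * R" using kk_ge[of p u] assms p by (intro mult_left_mono) auto
  then have "EE p u (Rlow p u) \<le> EE p u R" by (simp add: EE_def)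
  then show "EE p u R \<ge> (p - u) * (2 * (1 - p))" using EE_Rlow_ge[of u p] assms by simp
  moreover have "(p - u) * (2 * (1 - p)) > 0" using assms by simp
  ultimately show "EE p u R > 0" by linarith
qed

text \<open>On C = p this means \<open>Ff\<close> > 0 > \<open>Gf\<close>, so C increases to the
  left.\<close>

lemma NN_gt_EE_Rlow:
  assumes "u1 \<le> u" "u < p" "p < 1"
  shows "NN p u (Rlow p u) > EE p u (Rlow p u)"
proof -
  have p: "0 < p" "0 < u" "u1 \<le> p" using assms u1_bounds by auto
  have "NN p u (Rlow p u) - EE p u (Rlow p u) =
    (p - u) / u * ((u + m * zz p) * (p + u) / u + (g - 1) / 2 * m * (u - bb p))"
    unfolding NN_def EE_def Rlow_def qq_def hh_def kk_def using p
    by (simp add: divide_simps) (simp add: power2_eq_square algebra_simps)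
  also have "\<dots> > 0" using bracket_pos[of p u] assms p by (intro mult_pos_pos) auto
  finally show ?thesis by simp
qed

text \<open>Makes R increase to the left wherever R \<ge> R1 in the admissible region. Because
  \<open>hh\<close> \<ge> 1 and R1 = (g + 1) / 2 times 2 / (g - 1), it is enough that
  \<open>qq\<close> < 2 / (g - 1).\<close>

lemma NN_R1_pos:
  assumes "u1 \<le> u" "u \<le> p" "p < 1" and R: "R \<ge> R1"
  shows "NN p u R > 0"
proof -
  have p: "0 < p" "0 < u" "u1 \<le> p" using assms u1_bounds by auto
  note z = zb[OF p(1) assms(3)]
  have q: "qq p u < 2 / (g - 1)"
  proof (cases "bb p \<le> u")
    case True
    have "(p - u) * (u - bb p) \<ge> 0" using True assms by auto
    then have "m * (u - p) * (u - bb p) \<le> 0" using m_bounds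
      by (auto simp: mult_le_0_iff zero_le_mult_iff)
    then have "qq p u \<le> 0" using p by (simp add: qq_def divide_le_0_iff)
    also have "0 < 2 / (g - 1)" using g1 by simp
    finally show ?thesis .
  next
    case False
    \<comment> \<open>To the left of both roots the quotient (p - u) (\<open>bb p\<close> - u) / u
      is largest at the left end \<open>u1\<close>, where sum and product of the roots make it
      affine in z.\<close>
    have "(p - u) * (bb p - u) \<le> (p - u1) * (bb p - u1)"
      using False assms by (intro mult_mono) auto
    then have "m * ((p - u) * (bb p - u)) / u \<le> m * ((p - u1) * (bb p - u1)) / u1"
      using False assms m_bounds p u1_bounds by (intro frac_le mult_left_mono mult_nonneg_nonneg) auto
    moreover have "qq p u = m * ((p - u) * (bb p - u)) / u" by (simp add: qq_def algebra_simps)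
    moreover have "(p - u1) * (bb p - u1) / u1 = zz p * (4 * g - 2) / (g - 1) - 2 / (g + 1)"
    proof -
      have "(p - u1) * (bb p - u1) = g * zz p - u1 * (1 + (g - 2) * zz p) + u1 * u1"
        using z(4,5) by algebra
      then have "(p - u1) * (bb p - u1) / u1 = g * zz p / u1 - (1 + (g - 2) * zz p) + u1"
        using u1_bounds by (simp add: diff_divide_distrib add_divide_distrib)
      also have "\<dots> = zz p * (4 * g - 2) / (g - 1) - 2 / (g + 1)"
        using g1 by (simp add: u1_def divide_simps) (simp add: algebra_simps)
      finally show ?thesis .
    qed
    moreover have "m * (zz p * (4 * g - 2) / (g - 1) - 2 / (g + 1)) < 2 / (g - 1)"
    proof -
      have "m * (zz p * (4 * g - 2) * (g + 1) - 2 * (g - 1)) < 2 * (g + 1)"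
      proof -
        have "zz p < 1 / (g + 2)" using z(7) g1 by (simp add: field_simps)
        then have "zz p * ((4 * g - 2) * (g + 1)) < 1 / (g + 2) * ((4 * g - 2) * (g + 1))"
          using g1 by (intro mult_strict_right_mono) auto
        also have "\<dots> \<le> (g + 1) + 2 * (g - 1)"
        proof -
          \<comment> \<open>The difference of the two sides is 3 g - g^2, so this is where g \<le> 3
            decides. The resulting bound \<open>A\<close> is just what the case m = 2
            requires.\<close>
          have "(4 * g - 2) * (g + 1) \<le> ((g + 1) + 2 * (g - 1)) * (g + 2)"
            using mult_left_mono[OF g3, of g] g1 by (simp add: algebra_simps)
          then show ?thesis using g1 by (simp add: divide_le_eq)
        qed
        finally have A: "zz p * (4 * g - 2) * (g + 1) - 2 * (g - 1) < g + 1" by (simp add: mult.assoc)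
        show ?thesis using m A g1 by (elim disjE) auto
      qed
      then show ?thesis using g1 by (simp add: divide_simps)
    qed
    ultimately show ?thesis by (metis le_less_trans times_divide_eq_right)
  qed
  have "R1 \<le> hh p u * R"
    using mult_mono[of 1 "hh p u" R1 R] hh_ge[OF p(1) assms(3,2)] R R1_pos by simp
  moreover have "(g + 1) / 2 * qq p u < (g + 1) / 2 * (2 / (g - 1))"
    using q g1 by (intro mult_strict_left_mono) auto
  moreover have "(g + 1) / 2 * (2 / (g - 1)) = R1" using g1 by (simp add: R1_def divide_simps) (simp add: algebra_simps)
  ultimately show ?thesis unfolding NN_def by linarith
qed


section \<open>The slope at the sonic point\<close>

text \<open>With t = u / p - 1 and R = s t + ..., this is the coefficient of t in (1 + t) R'
  \<open>EE\<close> + 2 (1 + R) \<open>NN\<close>. The slope c of C in V satisfies s = 2 (c - 1), so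
  c < 0 means s < -2.\<close>

definition TT :: "real \<Rightarrow> real \<Rightarrow> real" where
  "TT p s = kk p p * s\<^sup>2 + (2 * hh p p - m * (p - bb p)) * s - (g + 1) * m * (p - bb p)"

definition disc :: "real \<Rightarrow> real" where
  "disc p = (2 * hh p p - m * (p - bb p))\<^sup>2 + 4 * kk p p * ((g + 1) * m * (p - bb p))"

definition ss :: "real \<Rightarrow> real" where
  "ss p = (m * (p - bb p) - 2 * hh p p - sqrt (disc p)) / (2 * kk p p)"

lemma k0_pos: "0 < p \<Longrightarrow> p < 1 \<Longrightarrow> kk p p > 0"
  using kk_ge[of p p] by simp

lemma TT_square:
  "4 * kk p p * TT p s = (2 * kk p p * s + (2 * hh p p - m * (p - bb p)))\<^sup>2 - disc p"
  by (simp add: TT_def disc_def power2_eq_square algebra_simps)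

text \<open>A multiple of \<open>bracket_pos\<close> at u = p. The parabola opens upwards, so -2
  separates two real roots, and \<open>ss p\<close> is the one below -2.\<close>

lemma TT_neg2: "u1 \<le> p \<Longrightarrow> p < 1 \<Longrightarrow> TT p (- 2) < 0"
proof -
  assume p: "u1 \<le> p" "p < 1"
  then have p0: "p > 0" using u1_bounds by simp
  have "TT p (- 2) = - 2 * ((p + m * zz p) * (p + p) / p + (g - 1) / 2 * m * (p - bb p))"
    using p0 by (simp add: TT_def kk_def hh_def field_simps)
  then show ?thesis using bracket_pos[OF p p(1) order_refl] by simp
qed

lemma disc_pos: "u1 \<le> p \<Longrightarrow> p < 1 \<Longrightarrow> disc p > 0"
proof -
  assume p: "u1 \<le> p" "p < 1"
  then have "kk p p > 0" using k0_pos[of p] u1_bounds by simp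
  then have "4 * kk p p * TT p (- 2) < 0" using TT_neg2[OF p] by (simp add: mult_pos_neg)
  then show ?thesis unfolding TT_square by (smt (verit) zero_le_power2)
qed

lemma ss_less:
  assumes p: "u1 \<le> p" "p < 1" and T: "TT p x < 0"
  shows "ss p < x"
proof -
  have k: "kk p p > 0" using k0_pos[of p] u1_bounds p by simp
  have "4 * kk p p * TT p x < 0" using T k by (simp add: mult_pos_neg)
  then have "(2 * kk p p * x + (2 * hh p p - m * (p - bb p)))\<^sup>2 < disc p" by (simp add: TT_square)
  then have "- (2 * kk p p * x + (2 * hh p p - m * (p - bb p))) < sqrt (disc p)"
    by (smt (verit, best) real_less_rsqrt power2_minus)
  then show ?thesis using k by (simp add: ss_def divide_less_eq) (simp add: algebra_simps)
qed

lemmas ss_less_neg2 = ss_less[OF _ _ TT_neg2]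

text \<open>The two positive quantities feed the singular equation: the second is V(0), and the
  first, equal to sqrt (\<open>disc p\<close>), is U(0) - V(0).\<close>

lemma
  assumes p: "u1 \<le> p" "p < 1"
  shows TT_ss: "TT p (ss p) = 0"
    and be_pos: "m * (p - bb p) - 2 * kk p p * ss p - 2 * hh p p > 0"
    and al_pos: "m * (p - bb p) - kk p p * ss p > 0"
proof -
  have k: "kk p p > 0" using k0_pos[of p] u1_bounds p by simp
  have e: "2 * kk p p * ss p = m * (p - bb p) - 2 * hh p p - sqrt (disc p)"
    using k by (simp add: ss_def)
  have "4 * kk p p * TT p (ss p) = 0" unfolding TT_square e using disc_pos[OF p] by simp
  then show "TT p (ss p) = 0" using k by simp
  show "m * (p - bb p) - 2 * kk p p * ss p - 2 * hh p p > 0" using e disc_pos[OF p] by simp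
  have "2 * kk p p + m * (p - bb p) > 0" using kk_shift_ge[of p p] p u1_bounds by simp
  moreover have "kk p p * ss p < kk p p * (- 2)"
    using ss_less_neg2[OF p p] k by (intro mult_strict_left_mono) auto
  ultimately show "m * (p - bb p) - kk p p * ss p > 0" by simp
qed

text \<open>Two distinct roots below -2 would make the parabola positive at -2.\<close>

lemma TT_root_unique:
  assumes p: "u1 \<le> p" "p < 1" and T: "TT p x = 0" and x: "x < - 2"
  shows "x = ss p"
proof (rule ccontr)
  assume ne: "x \<noteq> ss p"
  have k: "kk p p > 0" using k0_pos[of p] u1_bounds p by simp
  have "TT p x - TT p (ss p) = (x - ss p) * (kk p p * (x + ss p) + (2 * hh p p - m * (p - bb p)))"
    by (simp add: TT_def power2_eq_square algebra_simps)
  then have sum: "kk p p * (x + ss p) + (2 * hh p p - m * (p - bb p)) = 0"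
    using ne T TT_ss[OF p] by simp
  have "TT p (- 2) = TT p x + (- 2 - x) * (kk p p * (- 2 + x) + (2 * hh p p - m * (p - bb p)))"
    by (simp add: TT_def power2_eq_square algebra_simps)
  also have "kk p p * (- 2 + x) + (2 * hh p p - m * (p - bb p)) = kk p p * (- 2 - ss p)"
    using sum by (simp add: algebra_simps)
  also have "TT p x + (- 2 - x) * (kk p p * (- 2 - ss p)) = (- 2 - x) * (kk p p * (- 2 - ss p))" using T by simp
  also have "\<dots> > 0" using x k ss_less_neg2[OF p p] by (intro mult_pos_pos) auto
  finally show False using TT_neg2[OF p] by simp
qed

section \<open>The analytic family near the sonic point\<close>

lemma continuous_zz: "b < 1 \<Longrightarrow> continuous_on {u1..b} zz"
  unfolding zz_def using den_pos u1_bounds by (intro continuous_intros) (smt (verit) atLeastAtMost_iff)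

lemma continuous_bb: "b < 1 \<Longrightarrow> continuous_on {u1..b} bb"
  unfolding bb_def using den_pos u1_bounds by (intro continuous_intros) (smt (verit) atLeastAtMost_iff)

lemma continuous_ss: "b < 1 \<Longrightarrow> continuous_on {u1..b} ss"
proof -
  assume b: "b < 1"
  note [continuous_intros] = continuous_zz[OF b] continuous_bb[OF b]
  have "2 * kk p p \<noteq> 0" if "p \<in> {u1..b}" for p
    using k0_pos[of p] u1_bounds b that by auto
  then show ?thesis unfolding ss_def disc_def kk_def hh_def
    by (intro continuous_intros ballI) auto
qed

text \<open>With u = p (1 + t), R = t (ss p + t w), where ss p is the slope, the singular equation for w
  has the form treated above; sP is its inhomogeneity before dividing by t.\<close>

definition lP :: "real \<Rightarrow> real poly" where "lP p = [:m * (p - bb p), m * p:]"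
definition kP :: "real \<Rightarrow> real poly" where "kP p = [:kk p p, - ((m + 1) * p):]"
definition hP :: "real \<Rightarrow> real poly" where "hP p = [:hh p p, - (m * p):]"
definition sP :: "real \<Rightarrow> real poly" where
  "sP p = [:1, 1:] * lP p * [:ss p:] + [:- 1:] * [:1, 1:] * [:1, 1:] * kP p * [:ss p * ss p:]
     + [:-2:] * [:1, 1:] * hP p * [:ss p:] + [:g + 1:] * lP p
     + [:0, -2:] * [:1, 1:] * hP p * [:ss p * ss p:] + [:0, g + 1:] * [:ss p:] * lP p"
definition uP :: "real \<Rightarrow> real poly" where
  "uP p = [:2, 2:] * lP p + [:-3:] * [:1, 1:] * [:1, 1:] * kP p * [:ss p:] + [:-2:] * [:1, 1:] * hP p
     + [:0, -4:] * [:1, 1:] * hP p * [:ss p:] + [:0, g + 1:] * lP p"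
definition vP :: "real \<Rightarrow> real poly" where
  "vP p = [:1, 1:] * lP p + [:- 1:] * [:1, 1:] * [:1, 1:] * kP p * [:ss p:]"
definition dP :: "real \<Rightarrow> real poly" where
  "dP p = [:-2:] * [:1, 1:] * [:1, 1:] * kP p + [:0, -2:] * [:1, 1:] * hP p"
definition cP :: "real \<Rightarrow> real poly" where
  "cP p = [:- 1:] * [:1, 1:] * [:1, 1:] * kP p"

lemmas P_defs = lP_def kP_def hP_def sP_def uP_def vP_def dP_def cP_def

lemma cpoly_P:
  assumes b: "b < 1"
  shows "cpoly_on {u1..b} (\<lambda>p. poly_shift 1 (sP p))" "cpoly_on {u1..b} uP" "cpoly_on {u1..b} vP"
    "cpoly_on {u1..b} dP" "cpoly_on {u1..b} cP"
proof -
  note [continuous_intros] = continuous_zz[OF b] continuous_bb[OF b] continuous_ss[OF b]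
  have 1: "cpoly_on {u1..b} lP" "cpoly_on {u1..b} kP" "cpoly_on {u1..b} hP"
    unfolding lP_def[abs_def] kP_def[abs_def] hP_def[abs_def] kk_def hh_def
    by (intro cpoly_on_intros continuous_intros)+
  show "cpoly_on {u1..b} (\<lambda>p. poly_shift 1 (sP p))" "cpoly_on {u1..b} uP" "cpoly_on {u1..b} vP"
    "cpoly_on {u1..b} dP" "cpoly_on {u1..b} cP"
    unfolding sP_def[abs_def] uP_def[abs_def] vP_def[abs_def] dP_def[abs_def] cP_def[abs_def]
    by (intro cpoly_on_intros 1 continuous_intros)+
qed

text \<open>The constant term of \<open>sP p\<close> vanishes because \<open>ss p\<close> is a root
  of the slope quadratic; this makes \<open>poly_shift 1\<close> a genuine division by t.\<close>

lemma coeff_P_0: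
  "coeff (sP p) 0 = - TT p (ss p)" "coeff (vP p) 0 = m * (p - bb p) - kk p p * ss p"
  "coeff (uP p) 0 = 2 * (m * (p - bb p)) - 3 * kk p p * ss p - 2 * hh p p"
  by (simp_all add: P_defs TT_def power2_eq_square algebra_simps flip: poly_0_coeff_0)

lemma poly_shift1_eval: "poly (q :: real poly) t = coeff q 0 + t * poly (poly_shift 1 q) t"
proof -
  have "q = pCons (coeff q 0) (poly_shift 1 q)"
    by (rule poly_eqI) (auto simp: coeff_pCons coeff_poly_shift split: nat.split)
  then show ?thesis by (metis poly_pCons)
qed

text \<open>Here \<open>y\<close> stands for t w', so \<open>ss p + t * (2 * w + y)\<close> is the
  derivative of t r, and l is (1 + t) \<open>qq p u\<close> / t. The conclusion is the equation for
  R = t r with a common factor t removed from \<open>EE\<close> and \<open>NN\<close>.\<close>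

lemma scaled_ode:
  assumes p: "u1 \<le> p" "p < 1"
    and eq: "poly (poly_shift 1 (sP p)) t + poly (uP p) t * w + poly (vP p) t * y + t * (poly (dP p) t * w\<^sup>2 + poly (cP p) t * w * y) = 0"
  defines "r \<equiv> ss p + t * w" and "l \<equiv> m * (p - bb p + p * t)" and "u \<equiv> p * (1 + t)"
  shows "(1 + t) * (l - (1 + t) * kk p u * r) * (ss p + t * (2 * w + y))
     = 2 * (1 + t * r) * ((1 + t) * hh p u * r - (g + 1) / 2 * l)"
proof -
  have k: "kk p u = kk p p - (m + 1) * p * t" "hh p u = hh p p - m * p * t"
    by (simp_all add: kk_def hh_def u_def algebra_simps)
  have "poly (sP p) t = t * poly (poly_shift 1 (sP p)) t"
    using poly_shift1_eval[of "sP p" t] coeff_P_0(1)[of p] TT_ss[OF p] by simp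
  \<comment> \<open>Naming the fraction leaves a polynomial identity.\<close>
  moreover define c where "c = (g + 1) / 2"
  then have c: "g + 1 = 2 * c" by simp
  ultimately have "poly (sP p) t + t * (poly (uP p) t * w + poly (vP p) t * y + t * (poly (dP p) t * w\<^sup>2 + poly (cP p) t * w * y)) = 0"
    using eq by algebra
  then show ?thesis unfolding k r_def l_def c P_defs poly_mult poly_add poly_pCons poly_0
    by (simp add: power2_eq_square) algebra
qed


definition Rloc :: "real \<Rightarrow> real fps \<Rightarrow> real \<Rightarrow> real" where
  "Rloc p W t = t * (ss p + t * eval_fps W t)"

lemma Rloc_ode:
  assumes p: "u1 \<le> p" "p < 1" and t: "ereal \<bar>t\<bar> < fps_conv_radius W" "t \<noteq> 0" "- 1 < t"
    and eq: "sing_eq (poly_shift 1 (sP p)) (uP p) (vP p) (dP p) (cP p) W = 0"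
  shows "\<exists>D. (Rloc p W has_real_derivative D) (at t) \<and>
     (1 + t) * D * EE p (p * (1 + t)) (Rloc p W t) = - 2 * (1 + Rloc p W t) * NN p (p * (1 + t)) (Rloc p W t)"
proof -
  define w where "w = eval_fps W t"
  define w' where "w' = eval_fps (fps_deriv W) t"
  define D where "D = ss p + t * (2 * w + t * w')"
  define r where "r = ss p + t * w"
  define l where "l = m * (p - bb p + p * t)"
  define u where "u = p * (1 + t)"
  have p0: "p > 0" using p u1_bounds by simp
  have u0: "u > 0" using p0 t by (simp add: u_def)
  have "(eval_fps W has_real_derivative w') (at t)"
    unfolding w'_def by (rule has_field_derivative_eval_fps) (use t in simp)
  then have der: "(Rloc p W has_real_derivative D) (at t)"
    unfolding Rloc_def[abs_def] D_def w_def
    by (auto intro!: derivative_eq_intros simp: algebra_simps t w'_def)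
  have R: "Rloc p W t = t * r" by (simp add: Rloc_def r_def w_def)
  have e: "poly (poly_shift 1 (sP p)) t + poly (uP p) t * w + poly (vP p) t * (t * w')
      + t * (poly (dP p) t * w\<^sup>2 + poly (cP p) t * w * (t * w')) = 0"
    using eval_sing_eq[OF eq, of t] t by (simp add: w_def w'_def)
  from scaled_ode[OF p e]
  have key: "(1 + t) * (l - (1 + t) * kk p u * r) * D = 2 * (1 + t * r) * ((1 + t) * hh p u * r - (g + 1) / 2 * l)"
    by (simp add: D_def r_def l_def u_def)
  have q: "(1 + t) * qq p u = t * l"
    using p0 t unfolding qq_def l_def u_def by (simp add: divide_simps) (simp add: algebra_simps)
  have E: "(1 + t) * EE p u (t * r) = - t * (l - (1 + t) * kk p u * r)"
    unfolding EE_def right_diff_distrib q by (simp add: algebra_simps)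
  have N: "(1 + t) * NN p u (t * r) = t * ((1 + t) * hh p u * r - (g + 1) / 2 * l)"
    using q unfolding NN_def by algebra
  have "(1 + t) * ((1 + t) * D * EE p u (t * r)) = (1 + t) * (- 2 * (1 + t * r) * NN p u (t * r))"
    using E N key by algebra
  then have "(1 + t) * D * EE p u (t * r) = - 2 * (1 + t * r) * NN p u (t * r)" using t by simp
  then show ?thesis using der by (auto simp: R u_def)
qed

lemma Rloc_deriv_0:
  assumes "fps_conv_radius W > 0"
  shows "(Rloc p W has_real_derivative ss p) (at 0)"
proof -
  have "(eval_fps W has_real_derivative eval_fps (fps_deriv W) 0) (at 0)"
    by (rule has_field_derivative_eval_fps) (use assms in \<open>simp add: zero_ereal_def\<close>)
  then show ?thesis unfolding Rloc_def[abs_def]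
    by (auto intro!: derivative_eq_intros simp: assms assms[unfolded zero_ereal_def])
qed

text \<open>The last two conclusions place the start of the continuation in the region R < R1, C >
  p, as C = p (1 + t) sqrt (1 + R). A common \<open>e\<close> exists because \<open>ss\<close> stays
  away from -2 on the compact range of p.\<close>

lemma local_family:
  assumes b: "u1 < b" "b < 1"
  obtains e W where "0 < e" "e < 1" "u1 < b * (1 - e)"
    "\<And>p. p \<in> {u1..b} \<Longrightarrow> ereal e < fps_conv_radius (W p)"
    "\<And>p. p \<in> {u1..b} \<Longrightarrow> sing_eq (poly_shift 1 (sP p)) (uP p) (vP p) (dP p) (cP p) (W p) = 0"
    "continuous_on {u1..b} (\<lambda>p. Rloc p (W p) (- e))"
    "\<And>p t. p \<in> {u1..b} \<Longrightarrow> - e \<le> t \<Longrightarrow> t < 0 \<Longrightarrow> Rloc p (W p) t < R1"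
    "\<And>p t. p \<in> {u1..b} \<Longrightarrow> - e \<le> t \<Longrightarrow> t < 0 \<Longrightarrow> (1 + t)\<^sup>2 * (1 + Rloc p (W p) t) > 1"
proof -
  let ?S = "{u1..b}"
  have S: "compact ?S" "?S \<noteq> {}" using b by auto
  have pS: "u1 \<le> p" "p < 1" if "p \<in> ?S" for p using that b by auto
  have "coeff (vP p) 0 > 0" "coeff (uP p) 0 \<ge> coeff (vP p) 0" if "p \<in> ?S" for p
    using al_pos[OF pS[OF that]] be_pos[OF pS[OF that]] by (auto simp: coeff_P_0 algebra_simps)
  from singular_ode_family[OF S cpoly_P[OF b(2)] this]
  obtain \<tau> Y W where \<tau>: "0 < \<tau>" "\<tau> \<le> 1" and Y: "Y > 0"
    and W: "\<And>p. p \<in> ?S \<Longrightarrow> sing_eq (poly_shift 1 (sP p)) (uP p) (vP p) (dP p) (cP p) (W p) = 0"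
    and bnd: "\<And>p N. p \<in> ?S \<Longrightarrow> (\<Sum>n\<le>N. real (n + 1) * \<bar>fps_nth (W p) n\<bar> * \<tau> ^ n) \<le> Y"
    and cW: "\<And>n. continuous_on ?S (\<lambda>p. fps_nth (W p) n)" by blast
  note Wb = fps_conv_radius_geI_psum[OF bnd \<tau>(1)]
  obtain p1 where p1: "p1 \<in> ?S" "\<And>p. p \<in> ?S \<Longrightarrow> ss p \<le> ss p1"
    using continuous_attains_sup[OF S continuous_ss[OF b(2)]] by blast
  obtain p2 where p2: "p2 \<in> ?S" "\<And>p. p \<in> ?S \<Longrightarrow> ss p2 \<le> ss p"
    using continuous_attains_inf[OF S continuous_ss[OF b(2)]] by blast
  \<comment> \<open>Half the distance from -2 to the largest slope; the correction t w may use up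
    this half.\<close>
  define \<eta> where "\<eta> = (- 2 - ss p1) / 2"
  have \<eta>: "\<eta> > 0" using ss_less_neg2[OF pS pS, OF p1(1) p1(1) p1(1) p1(1)] by (simp add: \<eta>_def)
  define M where "M = - ss p2"
  have M: "M > 0" using ss_less_neg2[OF pS pS, OF p2(1) p2(1) p2(1) p2(1)] by (simp add: M_def)
  \<comment> \<open>The entries secure, in this order: continuity in p at t = -e; e < 1; slope
    quotient at most -2 - \<open>\<eta>\<close>; R < R1; C > p; and that b (1 - e) is still to the
    right of \<open>u1\<close>.\<close>
  define e where "e = Min {\<tau> / 2, 1 / 2, \<eta> / Y, R1 / (2 * (M + Y)), \<eta> / (2 * (3 + 2 * \<eta>)), (1 - u1 / b) / 2}"
  have e0: "0 < e" using \<tau> Y \<eta> M R1_pos b u1_bounds by (auto simp: e_def)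
  have e: "e \<le> \<tau> / 2" "e \<le> 1 / 2" "e \<le> \<eta> / Y" "e \<le> R1 / (2 * (M + Y))" "e \<le> \<eta> / (2 * (3 + 2 * \<eta>))" "e \<le> (1 - u1 / b) / 2"
    unfolding e_def by (rule Min_le; simp)+
  have e3: "e * Y \<le> \<eta>" using e(3) Y by (simp add: le_divide_eq)
  have e4: "e * (M + Y) < R1" using e(4) Y M R1_pos by (simp add: le_divide_eq algebra_simps)
  have e5: "e * (3 + 2 * \<eta>) < \<eta>" using e(5) \<eta> by (simp add: le_divide_eq algebra_simps)
  have "1 - u1 / b > 0" using b u1_bounds by simp
  from half_gt_zero[OF this] have "e < 1 - u1 / b" using e(6) field_sum_of_halves[of "1 - u1 / b"] by linarith
  then have e6: "u1 < b * (1 - e)" using b u1_bounds by (simp add: field_simps)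
  have near: "\<exists>r. Rloc p (W p) t = t * r \<and> r \<le> - 2 - \<eta> \<and> - (M + Y) \<le> r"
    if p: "p \<in> ?S" and t: "- e \<le> t" "t < 0" for p t
  proof (intro exI conjI)
    let ?w = "eval_fps (W p) t"
    show "Rloc p (W p) t = t * (ss p + t * ?w)" by (simp add: Rloc_def)
    have "\<bar>?w\<bar> \<le> Y" by (rule Wb(2)[OF p]) (use t e \<tau> in auto)
    then have "\<bar>t\<bar> * \<bar>?w\<bar> \<le> e * Y" using t e0 by (intro mult_mono) auto
    then have tw: "\<bar>t * ?w\<bar> \<le> e * Y" by (simp add: abs_mult)
    show "ss p + t * ?w \<le> - 2 - \<eta>" using tw e3 p1(2)[OF p] by (simp add: \<eta>_def abs_le_iff field_simps)
    have "e * Y \<le> 1 * Y" using e Y by (intro mult_right_mono) auto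
    then show "- (M + Y) \<le> ss p + t * ?w" using tw p2(2)[OF p] unfolding M_def by linarith
  qed
  show ?thesis
  proof (rule that[of e W])
    show "0 < e" "e < 1" "u1 < b * (1 - e)" using e0 e e6 by auto
    fix p assume p: "p \<in> ?S"
    have "ereal e < ereal \<tau>" using e \<tau> by simp
    then show "ereal e < fps_conv_radius (W p)" using Wb(1)[OF p] by (rule less_le_trans)
    show "sing_eq (poly_shift 1 (sP p)) (uP p) (vP p) (dP p) (cP p) (W p) = 0" by (rule W[OF p])
  next
    have "continuous_on ?S (\<lambda>p. eval_fps (W p) (- e))"
      by (rule continuous_on_eval_fps_param[OF cW \<tau>(1) Wb(3)]) (use e e0 in auto)
    then show "continuous_on ?S (\<lambda>p. Rloc p (W p) (- e))"
      unfolding Rloc_def by (intro continuous_intros continuous_ss b)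
  next
    fix p t assume p: "p \<in> ?S" and t: "- e \<le> t" "t < 0"
    obtain r where r: "Rloc p (W p) t = t * r" "r \<le> - 2 - \<eta>" "- (M + Y) \<le> r" using near[OF p t] by blast
    have "(- t) * (- r) \<le> e * (M + Y)" using t r \<eta> e0 by (intro mult_mono) auto
    then show "Rloc p (W p) t < R1" using e4 r(1) by simp
    define x where "x = - t"
    have x: "0 < x" "x \<le> e" using t by (auto simp: x_def)
    have "1 + Rloc p (W p) t \<ge> 1 + x * (2 + \<eta>)"
      using mult_left_mono[of "2 + \<eta>" "- r" x] r x by (simp add: x_def)
    then have "(1 - x)\<^sup>2 * (1 + Rloc p (W p) t) \<ge> (1 - x)\<^sup>2 * (1 + x * (2 + \<eta>))"
      by (intro mult_left_mono) auto
    \<comment> \<open>The slope -2 exactly balances the linear term of (1 - x)^2, so the surplus is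
      \<open>\<eta>\<close> x to first order.\<close>
    moreover have "(1 - x)\<^sup>2 * (1 + x * (2 + \<eta>)) = 1 + x * (\<eta> - x * (3 + 2 * \<eta>) + x\<^sup>2 * (2 + \<eta>))"
      by (simp add: power2_eq_square algebra_simps)
    moreover have "x * (3 + 2 * \<eta>) \<le> e * (3 + 2 * \<eta>)" using x \<eta> by (intro mult_right_mono) auto
    then have "x * (3 + 2 * \<eta>) < \<eta>" using e5 by linarith
    then have "x * (\<eta> - x * (3 + 2 * \<eta>) + x\<^sup>2 * (2 + \<eta>)) > 0"
      using x \<eta> by (intro mult_pos_pos add_pos_nonneg) auto
    ultimately show "(1 + t)\<^sup>2 * (1 + Rloc p (W p) t) > 1" by (simp add: x_def)
  qed
qed

end

section \<open>Continuation by the clamped equation\<close>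

lemma quot_lipschitz:
  fixes h k q c x y H \<delta> :: real
  assumes "\<bar>h\<bar> \<le> H" "\<bar>k\<bar> \<le> H" "\<bar>q\<bar> \<le> H" "\<bar>c\<bar> \<le> H" "\<bar>x\<bar> \<le> H" "\<bar>y\<bar> \<le> H"
    and \<delta>: "0 < \<delta>" "\<delta> \<le> k * x - q" "\<delta> \<le> k * y - q"
  shows "\<bar>(1 + x) * (h * x - c) / (k * x - q) - (1 + y) * (h * y - c) / (k * y - q)\<bar>
     \<le> (H ^ 4 + 2 * H ^ 3 + 3 * H ^ 2) / \<delta>\<^sup>2 * \<bar>x - y\<bar>"
proof -
  \<comment> \<open>The cofactor of x - y once both fractions are over a common denominator.\<close>
  define w where "w = h * k * (x * y) - h * q * (x + y) - (h - c) * q + c * k"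
  have H: "H \<ge> 0" using assms(1) by simp
  have e: "(1 + x) * (h * x - c) / (k * x - q) - (1 + y) * (h * y - c) / (k * y - q)
     = (x - y) * w / ((k * x - q) * (k * y - q))"
    using \<delta> by (simp add: w_def divide_simps) (simp add: algebra_simps)
  have 1: "\<bar>h * k * (x * y)\<bar> \<le> (H * H) * (H * H)"
    unfolding abs_mult using assms H by (intro mult_mono mult_nonneg_nonneg) auto
  have 2: "\<bar>h * q * (x + y)\<bar> \<le> (H * H) * (2 * H)"
    unfolding abs_mult using assms H by (intro mult_mono mult_nonneg_nonneg) auto
  have 3: "\<bar>(h - c) * q\<bar> \<le> (2 * H) * H"
    unfolding abs_mult using assms H by (intro mult_mono mult_nonneg_nonneg) auto
  have 4: "\<bar>c * k\<bar> \<le> H * H"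
    unfolding abs_mult using assms H by (intro mult_mono mult_nonneg_nonneg) auto
  have "\<bar>w\<bar> \<le> (H * H) * (H * H) + (H * H) * (2 * H) + (2 * H) * H + H * H"
    unfolding w_def using 1 2 3 4 by linarith
  also have "\<dots> = H ^ 4 + 2 * H ^ 3 + 3 * H ^ 2" by (simp add: eval_nat_numeral algebra_simps)
  finally have w: "\<bar>w\<bar> \<le> H ^ 4 + 2 * H ^ 3 + 3 * H ^ 2" .
  have d: "\<delta>\<^sup>2 \<le> (k * x - q) * (k * y - q)"
    unfolding power2_eq_square using \<delta> by (intro mult_mono) auto
  have "\<bar>(x - y) * w / ((k * x - q) * (k * y - q))\<bar> = \<bar>x - y\<bar> * \<bar>w\<bar> / ((k * x - q) * (k * y - q))"
    using \<delta> by (simp add: abs_mult)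
  also have "\<dots> \<le> \<bar>x - y\<bar> * (H ^ 4 + 2 * H ^ 3 + 3 * H ^ 2) / \<delta>\<^sup>2"
    using w d \<delta> H by (intro frac_le mult_left_mono) auto
  finally show ?thesis unfolding e by (simp add: mult.commute)
qed

context shock begin

text \<open>Equal to -dR/du: positive values mean growth of R to the left.\<close>

definition phi :: "real \<Rightarrow> real \<Rightarrow> real \<Rightarrow> real" where
  "phi p u x = 2 / u * ((1 + x) * NN p u x / EE p u x)"

text \<open>The maximum is outermost because \<open>Rlow\<close> may exceed \<open>R1\<close>: the
  clamped value never drops below \<open>Rlow\<close>, which keeps \<open>EE\<close>
  positive.\<close>

definition Rcl :: "real \<Rightarrow> real \<Rightarrow> real \<Rightarrow> real" where
  "Rcl p u x = max (Rlow p u) (min R1 x)"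

text \<open>Leads from p (1 - e) at time 0 to \<open>u1\<close> at time 1, so that all p share one
  time interval.\<close>

definition upt_of :: "real \<Rightarrow> real \<Rightarrow> real \<Rightarrow> real" where
  "upt_of e p \<sigma> = p * (1 - e) - \<sigma> * (p * (1 - e) - u1)"

lemma upt_of_bounds:
  assumes e: "0 < e" "e < 1" and p: "u1 / (1 - e) \<le> p" and \<sigma>: "\<sigma> \<in> {0..1}"
  shows "u1 \<le> upt_of e p \<sigma>" "upt_of e p \<sigma> \<le> p * (1 - e)" "u1 \<le> p * (1 - e)" "u1 < p" "p * (1 - e) < p"
proof -
  show up: "u1 \<le> p * (1 - e)" using p e by (simp add: divide_le_eq)
  have "0 \<le> \<sigma> * (p * (1 - e) - u1)" using up \<sigma> by auto
  then show "upt_of e p \<sigma> \<le> p * (1 - e)" by (simp add: upt_of_def)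
  have "\<sigma> * (p * (1 - e) - u1) \<le> 1 * (p * (1 - e) - u1)" using up \<sigma> by (intro mult_right_mono) auto
  then show "u1 \<le> upt_of e p \<sigma>" by (simp add: upt_of_def)
  have p0: "p > 0" using up u1_bounds e by (smt (verit) mult_nonpos_nonneg)
  then show "p * (1 - e) < p" using e by simp
  with up show "u1 < p" by simp
qed

text \<open>The left end of the p-range is where p (1 - e) = \<open>u1\<close>; the speed factor
  vanishes there. Clamping makes the right-hand side bounded and globally Lipschitz, as the Picard
  argument requires.\<close>

lemma truncated_family:
  fixes b e :: real
  assumes b: "u1 < b" "b < 1" and e: "0 < e" "e < 1" "u1 \<le> b * (1 - e)"
    and x0: "continuous_on {u1..b} x0"
  obtains X where "continuous_on {u1 / (1 - e)..b} (\<lambda>p. X p 1)"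
    "\<And>p. p \<in> {u1 / (1 - e)..b} \<Longrightarrow> X p 0 = x0 p"
    "\<And>p \<sigma>. p \<in> {u1 / (1 - e)..b} \<Longrightarrow> \<sigma> \<in> {0..1} \<Longrightarrow>
       (X p has_real_derivative (p * (1 - e) - u1) * phi p (upt_of e p \<sigma>) (Rcl p (upt_of e p \<sigma>) (X p \<sigma>)))
         (at \<sigma> within {0..1})"
proof -
  let ?I = "{u1 / (1 - e)..b}"
  let ?D = "?I \<times> {0..1::real} \<times> (UNIV :: real set)"
  define f where "f p \<sigma> x = (p * (1 - e) - u1) * phi p (upt_of e p \<sigma>) (Rcl p (upt_of e p \<sigma>) x)" for p \<sigma> x
  \<comment> \<open>From \<open>EE_pos\<close>, with p - u \<ge> p e \<ge> \<open>u1\<close> e and 1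
    - p \<ge> 1 - b.\<close>
  define \<delta> where "\<delta> = u1 * e * (2 * (1 - b))"
  have \<delta>: "\<delta> > 0" using u1_bounds e b by (simp add: \<delta>_def)
  \<comment> \<open>One bound for all coefficients and the clamped R: 3 serves \<open>hh\<close> and
    \<open>kk\<close>, the term 4 / \<open>u1\<close> comes from |\<open>qq\<close>| \<le> 2 /
    \<open>u1\<close> and (g + 1) / 2 \<le> 2, and the rest bounds \<open>Rlow\<close> and
    \<open>R1\<close>.\<close>
  define H where "H = 3 + 4 / u1 + 1 / u1\<^sup>2 + R1"
  have H: "3 \<le> H" "4 / u1 \<le> H" "1 / u1\<^sup>2 + R1 \<le> H" "0 \<le> H" using u1_bounds R1_pos by (auto simp: H_def)
  have geo: "u1 \<le> upt_of e p \<sigma>" "upt_of e p \<sigma> \<le> p * (1 - e)" "upt_of e p \<sigma> < p" "u1 \<le> p * (1 - e)" "u1 < p" "p < 1" "0 < p" "0 < upt_of e p \<sigma>"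
    "p * (1 - e) < p"
    if "p \<in> ?I" "\<sigma> \<in> {0..1}" for p \<sigma>
    using upt_of_bounds[OF e(1,2), of p \<sigma>] that b u1_bounds unfolding atLeastAtMost_iff by linarith+
  have Eb: "\<delta> \<le> EE p (upt_of e p \<sigma>) (Rcl p (upt_of e p \<sigma>) x)" if p: "p \<in> ?I" "\<sigma> \<in> {0..1}" for p \<sigma> x
  proof -
    note G = geo[OF p]
    have "u1 * e \<le> p * e" using G e by (intro mult_right_mono) auto
    then have "u1 * e \<le> p - upt_of e p \<sigma>" using G by (simp add: algebra_simps)
    then have "u1 * e * (2 * (1 - b)) \<le> (p - upt_of e p \<sigma>) * (2 * (1 - p))"
      using p b G u1_bounds e by (intro mult_mono) auto
    also have "\<dots> \<le> EE p (upt_of e p \<sigma>) (Rcl p (upt_of e p \<sigma>) x)"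
      by (rule EE_pos(1)) (use G in \<open>auto simp: Rcl_def\<close>)
    finally show ?thesis by (simp add: \<delta>_def)
  qed
  have bds: "\<bar>hh p (upt_of e p \<sigma>)\<bar> \<le> H" "\<bar>kk p (upt_of e p \<sigma>)\<bar> \<le> H" "\<bar>qq p (upt_of e p \<sigma>)\<bar> \<le> H"
    "\<bar>(g + 1) / 2 * qq p (upt_of e p \<sigma>)\<bar> \<le> H" "\<bar>Rcl p (upt_of e p \<sigma>) x\<bar> \<le> H"
    if p: "p \<in> ?I" "\<sigma> \<in> {0..1}" for p \<sigma> x
  proof -
    define u where "u = upt_of e p \<sigma>"
    note G = geo[OF p, folded u_def]
    note z = zb[OF G(7,6)]
    have mu: "m * (1 - u) \<le> 2 * 1" using m_bounds G by (intro mult_mono) auto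
    have mz: "m * zz p \<ge> 0" using m_bounds z by auto
    show "\<bar>hh p u\<bar> \<le> H" using hh_ge[OF G(7,6), of u] G mu mz H by (simp add: hh_def)
    show "\<bar>kk p u\<bar> \<le> H" using kk_ge[OF G(7,6), of u] G mu mz H by (simp add: kk_def algebra_simps)
    have "\<bar>m * (u - p) * (u - bb p)\<bar> \<le> 2 * 1 * 1"
      unfolding abs_mult using m_bounds G z by (intro mult_mono) auto
    then have "\<bar>m * (u - p) * (u - bb p)\<bar> / \<bar>u\<bar> \<le> 2 / u1"
      using G u1_bounds by (intro frac_le) auto
    then have q: "\<bar>qq p u\<bar> \<le> 2 / u1" by (simp add: qq_def)
    also have "\<dots> \<le> 4 / u1" using u1_bounds by (intro divide_right_mono) auto
    finally show "\<bar>qq p u\<bar> \<le> H" using H by simp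
    have "\<bar>(g + 1) / 2 * qq p u\<bar> \<le> 2 * (2 / u1)"
      unfolding abs_mult using q g1 g3 by (intro mult_mono) auto
    then show "\<bar>(g + 1) / 2 * qq p u\<bar> \<le> H" using H by simp
    have "u\<^sup>2 \<le> p\<^sup>2" using G by (intro power_mono) auto
    then have "Rlow p u \<ge> 0" using G by (simp add: Rlow_def)
    moreover have "p\<^sup>2 \<le> 1" "u1\<^sup>2 \<le> u\<^sup>2" using G u1_bounds by (auto intro!: power_le_one power_mono)
    then have "p\<^sup>2 / u\<^sup>2 \<le> 1 / u1\<^sup>2" using u1_bounds by (intro frac_le) auto
    then have "Rlow p u \<le> H" using H R1_pos by (simp add: Rlow_def)
    moreover have "R1 \<le> H" using H u1_bounds by (smt (verit) divide_nonneg_nonneg zero_le_power2)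
    ultimately show "\<bar>Rcl p u x\<bar> \<le> H" by (auto simp: Rcl_def)
  qed
  have fac: "\<bar>(p * (1 - e) - u1) * (2 / upt_of e p \<sigma>)\<bar> \<le> 2 / u1" if p: "p \<in> ?I" "\<sigma> \<in> {0..1}" for p \<sigma>
  proof -
    note G = geo[OF p]
    have "\<bar>(p * (1 - e) - u1) * (2 / upt_of e p \<sigma>)\<bar> \<le> 1 * (2 / u1)"
      unfolding abs_mult using G u1_bounds by (intro mult_mono) (auto simp: frac_le)
    then show ?thesis by simp
  qed
  have f_eq: "f p \<sigma> x = (p * (1 - e) - u1) * (2 / upt_of e p \<sigma>) * ((1 + Rcl p (upt_of e p \<sigma>) x) *
     (hh p (upt_of e p \<sigma>) * Rcl p (upt_of e p \<sigma>) x - (g + 1) / 2 * qq p (upt_of e p \<sigma>)) /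
       (kk p (upt_of e p \<sigma>) * Rcl p (upt_of e p \<sigma>) x - qq p (upt_of e p \<sigma>)))" for p \<sigma> x
    unfolding f_def phi_def NN_def EE_def by (simp only: mult.assoc)
  define L where "L = 2 / u1 * ((H ^ 4 + 2 * H ^ 3 + 3 * H ^ 2) / \<delta>\<^sup>2)"
  have "0 < H" using H by simp
  then have L: "L > 0" using u1_bounds \<delta> by (auto simp: L_def intro!: divide_pos_pos mult_pos_pos add_pos_pos)
  have lip: "\<bar>f p \<sigma> x - f p \<sigma> y\<bar> \<le> L * \<bar>x - y\<bar>" if p: "p \<in> ?I" "\<sigma> \<in> {0..1}" for p \<sigma> x y
  proof -
    define u where "u = upt_of e p \<sigma>"
    have "\<bar>f p \<sigma> x - f p \<sigma> y\<bar> = \<bar>(p * (1 - e) - u1) * (2 / u)\<bar> *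
       \<bar>(1 + Rcl p u x) * (hh p u * Rcl p u x - (g + 1) / 2 * qq p u) / (kk p u * Rcl p u x - qq p u)
      - (1 + Rcl p u y) * (hh p u * Rcl p u y - (g + 1) / 2 * qq p u) / (kk p u * Rcl p u y - qq p u)\<bar>"
      unfolding f_eq u_def[symmetric] right_diff_distrib[symmetric] abs_mult[symmetric] ..
    also have "\<dots> \<le> 2 / u1 * ((H ^ 4 + 2 * H ^ 3 + 3 * H ^ 2) / \<delta>\<^sup>2 * \<bar>Rcl p u x - Rcl p u y\<bar>)"
      using fac[OF p] Eb[OF p] bds[OF p] \<delta> u1_bounds
      by (intro mult_mono quot_lipschitz) (auto simp: u_def EE_def)
    also have "\<dots> = L * \<bar>Rcl p u x - Rcl p u y\<bar>" by (simp add: L_def)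
    also have "\<dots> \<le> L * \<bar>x - y\<bar>" using L by (intro mult_left_mono) (auto simp: Rcl_def)
    finally show ?thesis .
  qed
  have bnd: "\<bar>f p \<sigma> x\<bar> \<le> 2 / u1 * ((1 + H) * (H * H + H) / \<delta>)" if p: "p \<in> ?I" "\<sigma> \<in> {0..1}" for p \<sigma> x
  proof -
    define u where "u = upt_of e p \<sigma>"
    note B = bds[OF p, folded u_def]
    have 1: "\<bar>1 + Rcl p u x\<bar> \<le> 1 + H" using B(5)[of x] by linarith
    have "\<bar>hh p u * Rcl p u x\<bar> \<le> H * H"
      unfolding abs_mult using B H by (intro mult_mono) auto
    then have 2: "\<bar>hh p u * Rcl p u x - (g + 1) / 2 * qq p u\<bar> \<le> H * H + H" using B(4) by linarith
    have "\<bar>(1 + Rcl p u x) * (hh p u * Rcl p u x - (g + 1) / 2 * qq p u) / (kk p u * Rcl p u x - qq p u)\<bar>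
      \<le> (1 + H) * (H * H + H) / \<delta>"
      unfolding abs_divide abs_mult[of "1 + Rcl p u x"] using 1 2 H \<delta> Eb[OF p, of x]
      by (intro frac_le mult_mono) (auto simp: u_def EE_def)
    then show ?thesis unfolding f_eq u_def[symmetric] abs_mult[of "(p * (1 - e) - u1) * (2 / u)"]
      using fac[OF p] H \<delta> u1_bounds by (intro mult_mono) (auto simp: u_def)
  qed
  have contf: "continuous_on ?D (\<lambda>(p, \<sigma>, x). f p \<sigma> x)"
  proof -
    have sub: "?I \<subseteq> {u1..b}" using geo(5)[of _ 0] by force
    have cz: "continuous_on ?D (\<lambda>w. zz (fst w))"
      by (rule continuous_on_compose2[OF continuous_zz[OF b(2)]]) (use sub in \<open>auto intro!: continuous_intros\<close>)
    have cb: "continuous_on ?D (\<lambda>w. bb (fst w))"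
      by (rule continuous_on_compose2[OF continuous_bb[OF b(2)]]) (use sub in \<open>auto intro!: continuous_intros\<close>)
    have cu: "continuous_on ?D (\<lambda>w. upt_of e (fst w) (fst (snd w)))"
      unfolding upt_of_def by (intro continuous_intros)
    have un: "\<forall>w\<in>?D. upt_of e (fst w) (fst (snd w)) \<noteq> 0" using geo(8) by force
    have ck: "continuous_on ?D (\<lambda>w. kk (fst w) (upt_of e (fst w) (fst (snd w))))"
      unfolding kk_def by (intro continuous_intros cz cu)
    have ch: "continuous_on ?D (\<lambda>w. hh (fst w) (upt_of e (fst w) (fst (snd w))))"
      unfolding hh_def by (intro continuous_intros cz cu)
    have cq: "continuous_on ?D (\<lambda>w. qq (fst w) (upt_of e (fst w) (fst (snd w))))"
      unfolding qq_def by (intro continuous_intros cb cu un)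
    have cR: "continuous_on ?D (\<lambda>w. Rcl (fst w) (upt_of e (fst w) (fst (snd w))) (snd (snd w)))"
      unfolding Rcl_def Rlow_def by (intro continuous_intros cu) (use un in auto)
    have En: "\<forall>w\<in>?D. kk (fst w) (upt_of e (fst w) (fst (snd w))) * Rcl (fst w) (upt_of e (fst w) (fst (snd w))) (snd (snd w))
        - qq (fst w) (upt_of e (fst w) (fst (snd w))) \<noteq> 0"
    proof
      fix w assume "w \<in> ?D"
      then have "fst w \<in> ?I" "fst (snd w) \<in> {0..1}" by auto
      from Eb[OF this, of "snd (snd w)"] \<delta> show "kk (fst w) (upt_of e (fst w) (fst (snd w))) * Rcl (fst w) (upt_of e (fst w) (fst (snd w))) (snd (snd w))
        - qq (fst w) (upt_of e (fst w) (fst (snd w))) \<noteq> 0"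
        unfolding EE_def by linarith
    qed
    show ?thesis unfolding f_eq case_prod_beta
      by (intro continuous_intros cu un ck ch cq cR En)
  qed
  have pab: "u1 / (1 - e) \<le> b" using e by (simp add: divide_le_eq)
  have "continuous_on ?I x0" by (rule continuous_on_subset[OF x0]) (use geo(5)[of _ 0] in force)
  from parametric_picard[OF pab contf lip bnd this L]
  show ?thesis using that unfolding f_def by blast
qed

end

section \<open>Removing the clamps and gluing\<close>

text \<open>For gluing at the junction point. Closedness makes the limit along a set trivial at
  points outside it.\<close>

lemma has_field_derivative_within_Un:
  assumes "x \<in> S \<Longrightarrow> (f has_field_derivative D) (at x within S)"
    "x \<in> T \<Longrightarrow> (f has_field_derivative D) (at x within T)" and "closed S" "closed T"
  shows "(f has_field_derivative D) (at x within S \<union> T)"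
proof -
  have "((\<lambda>y. (f y - f x) / (y - x)) \<longlongrightarrow> D) (at x within A)"
    if "x \<in> A \<Longrightarrow> (f has_field_derivative D) (at x within A)" "closed A" for A
  proof (cases "x \<in> A")
    case False
    then have "at x within A = bot" using that(2) by (intro not_in_closure_trivial_limitI) auto
    then show ?thesis by simp
  qed (use that in \<open>simp add: has_field_derivative_iff\<close>)
  from this[OF assms(1,3)] this[OF assms(2,4)] show ?thesis
    by (simp add: has_field_derivative_iff Lim_within_Un)
qed

context shock begin

lemma Rlow_nonneg: "0 < u \<Longrightarrow> u \<le> p \<Longrightarrow> 0 \<le> Rlow p u"
  using power_mono[of u p 2] by (simp add: Rlow_def)

lemma phi_pos_at_R1:
  assumes "u1 \<le> u" "u < p" "p < 1" "R1 \<le> x" "Rlow p u \<le> x"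
  shows "phi p u x > 0"
proof -
  have "0 < u" using assms u1_bounds by simp
  moreover have "NN p u x > 0" using NN_R1_pos[of u p x] assms by simp
  moreover have "EE p u x > 0" using EE_pos(2)[of u p x] assms by simp
  ultimately show ?thesis unfolding phi_def using assms R1_pos by simp
qed

text \<open>The right-hand side is minus the u-derivative of \<open>Rlow p\<close>; to the left, R
  therefore grows faster than the curve it might touch.\<close>

lemma phi_Rlow:
  assumes "u1 \<le> u" "u < p" "p < 1"
  shows "phi p u (Rlow p u) > 2 * p\<^sup>2 / u ^ 3"
proof -
  have u: "0 < u" using assms u1_bounds by simp
  have E: "EE p u (Rlow p u) > 0" using EE_pos(2)[OF assms order_refl] .
  have "1 < NN p u (Rlow p u) / EE p u (Rlow p u)" using NN_gt_EE_Rlow[OF assms] E by simp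
  then have "2 * p\<^sup>2 / u ^ 3 * 1 < 2 * p\<^sup>2 / u ^ 3 * (NN p u (Rlow p u) / EE p u (Rlow p u))"
    using u assms by (intro mult_strict_left_mono) auto
  also have "\<dots> = phi p u (Rlow p u)" using u E by (simp add: phi_def Rlow_def field_simps eval_nat_numeral)
  finally show ?thesis by simp
qed

text \<open>The upper clamp is excluded from the end: a solution once above R1 would still be above
  it at time 1. The lower clamp is excluded from the start, where C > p.\<close>

lemma clamp_inactive:
  assumes e: "0 < e" "e < 1" and p: "u1 / (1 - e) < p" "p < 1"
    and X: "\<And>\<sigma>. \<sigma> \<in> {0..1} \<Longrightarrow>
       (X has_real_derivative (p * (1 - e) - u1) * phi p (upt_of e p \<sigma>) (Rcl p (upt_of e p \<sigma>) (X \<sigma>))) (at \<sigma> within {0..1})"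
    and X0: "X 0 > Rlow p (p * (1 - e))" and X1: "X 1 \<le> R1" and \<sigma>: "\<sigma> \<in> {0..1}"
  shows "Rlow p (upt_of e p \<sigma>) < X \<sigma>" "X \<sigma> \<le> R1"
proof -
  define c where "c = p * (1 - e) - u1"
  have c: "c > 0" using p e by (simp add: c_def divide_less_eq)
  have geo: "u1 \<le> upt_of e p s" "upt_of e p s < p" "0 < upt_of e p s" if "s \<in> {0..1}" for s
    using upt_of_bounds[OF e, of p s] that p u1_bounds by linarith+
  show "X \<sigma> \<le> R1"
  proof (rule ccontr)
    assume gt: "\<not> X \<sigma> \<le> R1"
    have "X 1 - R1 > 0"
    proof (rule barrier[of \<sigma> 1 "\<lambda>s. X s - R1" "\<lambda>s. c * phi p (upt_of e p s) (Rcl p (upt_of e p s) (X s))"])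
      fix s assume "s \<in> {\<sigma>..1}"
      then have s: "s \<in> {0..1}" using \<sigma> by auto
      have "(X has_real_derivative c * phi p (upt_of e p s) (Rcl p (upt_of e p s) (X s))) (at s within {\<sigma>..1})"
        unfolding c_def by (rule DERIV_subset[OF X[OF s]]) (use \<sigma> in auto)
      then show "((\<lambda>s. X s - R1) has_real_derivative c * phi p (upt_of e p s) (Rcl p (upt_of e p s) (X s))) (at s within {\<sigma>..1})"
        by (auto intro!: derivative_eq_intros)
      assume "X s - R1 = 0"
      \<comment> \<open>The clamped value is here the maximum of \<open>Rlow\<close> and R1, which
        meets both lower bounds required of it.\<close>
      then have "phi p (upt_of e p s) (Rcl p (upt_of e p s) (X s)) > 0"
        using geo[OF s] p by (intro phi_pos_at_R1) (auto simp: Rcl_def)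
      then show "c * phi p (upt_of e p s) (Rcl p (upt_of e p s) (X s)) > 0" using c by simp
    qed (use gt \<sigma> in auto)
    then show False using X1 by simp
  qed
  have "X \<sigma> - Rlow p (upt_of e p \<sigma>) > 0"
  proof (rule barrier[of 0 1 "\<lambda>s. X s - Rlow p (upt_of e p s)"
        "\<lambda>s. c * (phi p (upt_of e p s) (Rcl p (upt_of e p s) (X s)) - 2 * p\<^sup>2 / upt_of e p s ^ 3)"])
    fix s assume s: "s \<in> {0..1::real}"
    have "(upt_of e p has_real_derivative - c) (at s within {0..1})"
      unfolding upt_of_def[abs_def] c_def by (auto intro!: derivative_eq_intros)
    then have "((\<lambda>s. X s - Rlow p (upt_of e p s)) has_real_derivative
      c * phi p (upt_of e p s) (Rcl p (upt_of e p s) (X s)) - p\<^sup>2 * (2 * c * upt_of e p s) / (upt_of e p s ^ 2)\<^sup>2) (at s within {0..1})"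
      unfolding Rlow_def using X[OF s, folded c_def] geo[OF s]
      by (auto intro!: derivative_eq_intros simp: power2_eq_square)
    moreover have "p\<^sup>2 * (2 * c * upt_of e p s) / (upt_of e p s ^ 2)\<^sup>2 = c * (2 * p\<^sup>2 / upt_of e p s ^ 3)"
      using geo[OF s] by (simp add: eval_nat_numeral)
    ultimately show "((\<lambda>s. X s - Rlow p (upt_of e p s)) has_real_derivative
      c * (phi p (upt_of e p s) (Rcl p (upt_of e p s) (X s)) - 2 * p\<^sup>2 / upt_of e p s ^ 3)) (at s within {0..1})"
      by (simp add: right_diff_distrib)
    assume "X s - Rlow p (upt_of e p s) = 0"
    then have "Rcl p (upt_of e p s) (X s) = Rlow p (upt_of e p s)" by (auto simp: Rcl_def)
    then show "c * (phi p (upt_of e p s) (Rcl p (upt_of e p s) (X s)) - 2 * p\<^sup>2 / upt_of e p s ^ 3) > 0"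
      using phi_Rlow[OF geo(1)[OF s] geo(2)[OF s] p(2)] c by simp
  qed (use X0 \<sigma> in \<open>auto simp: upt_of_def\<close>)
  then show "Rlow p (upt_of e p \<sigma>) < X \<sigma>" by simp
qed

text \<open>The series is used to the right of p (1 - e), the time-reversed continuation to the
  left. With the clamps inactive both satisfy the same equation, so the one-sided derivatives agree
  at the junction.\<close>

lemma global_solution:
  assumes e: "0 < e" "e < 1" and p: "u1 / (1 - e) < p" "p < 1"
    and X: "\<And>\<sigma>. \<sigma> \<in> {0..1} \<Longrightarrow>
       (X has_real_derivative (p * (1 - e) - u1) * phi p (upt_of e p \<sigma>) (Rcl p (upt_of e p \<sigma>) (X \<sigma>))) (at \<sigma> within {0..1})"
    and X0: "X 0 = Rloc p W (- e)" and X1: "X 1 \<le> R1"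
    and rad: "ereal e < fps_conv_radius W"
    and eq: "sing_eq (poly_shift 1 (sP p)) (uP p) (vP p) (dP p) (cP p) W = 0"
    and loc1: "\<And>t. - e \<le> t \<Longrightarrow> t < 0 \<Longrightarrow> Rloc p W t < R1"
    and loc2: "\<And>t. - e \<le> t \<Longrightarrow> t < 0 \<Longrightarrow> (1 + t)\<^sup>2 * (1 + Rloc p W t) > 1"
  obtains R where "\<And>u. p * (1 - e) \<le> u \<Longrightarrow> R u = Rloc p W (u / p - 1)" "R u1 = X 1"
    "\<And>u. u1 \<le> u \<Longrightarrow> u < p \<Longrightarrow> Rlow p u < R u"
    "\<And>u. u1 \<le> u \<Longrightarrow> u < p \<Longrightarrow> R u \<le> R1"
    "\<And>u. u1 \<le> u \<Longrightarrow> u < p \<Longrightarrow> (R has_real_derivative - phi p u (R u)) (at u within {u1..p})"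
proof -
  define c where "c = p * (1 - e) - u1"
  define u0 where "u0 = p * (1 - e)"
  have c: "c > 0" using p e by (simp add: c_def divide_less_eq)
  have pp: "u1 < p" "p < 1" "0 < p" "u1 \<le> p" "u0 < p" "u1 < u0"
    using upt_of_bounds[OF e, of p 0] p u1_bounds c by (auto simp: u0_def c_def)
  define R where "R u = (if u0 \<le> u then Rloc p W (u / p - 1) else X ((u0 - u) / c))" for u
  have u0p: "u0 / p - 1 = - e" using pp by (simp add: u0_def field_simps)
  have RA: "R u = X ((u0 - u) / c)" if "u \<le> u0" for u
    using that X0 u0p by (cases "u = u0") (auto simp: R_def)
  have RB: "R u = Rloc p W (u / p - 1)" if "u0 \<le> u" for u using that by (simp add: R_def)
  have tB: "- e \<le> u / p - 1" "u / p - 1 < 0" if "u0 \<le> u" "u < p" for u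
    using that pp by (auto simp: u0_def field_simps)
  have sA: "(u0 - u) / c \<in> {0..1}" "upt_of e p ((u0 - u) / c) = u" if "u1 \<le> u" "u \<le> u0" for u
  proof -
    show "(u0 - u) / c \<in> {0..1}" using that c by (auto simp: divide_le_eq c_def u0_def)
    have "upt_of e p ((u0 - u) / c) = u0 - (u0 - u) / c * c" by (simp add: upt_of_def c_def u0_def)
    then show "upt_of e p ((u0 - u) / c) = u" using c by simp
  qed
  have lowB: "Rlow p u < Rloc p W (u / p - 1)" if "u0 \<le> u" "u < p" for u
  proof -
    have u: "0 < u" using that pp u1_bounds by simp
    have "(u / p)\<^sup>2 * (1 + Rloc p W (u / p - 1)) > 1" using loc2[OF tB[OF that]] by simp
    then show ?thesis using u pp by (simp add: Rlow_def field_simps)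
  qed
  have X0': "X 0 > Rlow p (p * (1 - e))" using lowB[of u0] pp u0p X0 by (simp add: u0_def)
  note cl = clamp_inactive[OF e p X X0' X1]
  have low: "Rlow p u < R u" if "u1 \<le> u" "u < p" for u
    using that lowB[of u] cl(1)[OF _ sA(1)[of u]] sA(2)[of u] RA[of u] RB[of u] by (cases "u0 \<le> u") auto
  have up: "R u \<le> R1" if "u1 \<le> u" "u < p" for u
    using that loc1[of "u / p - 1"] tB[of u] cl(2)[OF _ sA(1)[of u]] RA[of u] RB[of u] by (cases "u0 \<le> u") force+
  have derA: "(R has_real_derivative - phi p u (R u)) (at u within {u1..u0})" if u: "u \<in> {u1..u0}" for u
  proof -
    let ?s = "\<lambda>u. (u0 - u) / c"
    have su: "?s u \<in> {0..1}" "upt_of e p (?s u) = u" using sA[of u] u by auto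
    have "Rcl p u (R u) = R u" using low[of u] up[of u] u pp by (auto simp: Rcl_def)
    then have "(X has_real_derivative c * phi p u (R u)) (at (?s u) within {0..1})"
      using X[OF su(1)] RA[of u] u unfolding su(2) c_def[symmetric] by simp
    moreover have "?s ` {u1..u0} \<subseteq> {0..1}" using sA(1) by auto
    ultimately have "(X has_real_derivative c * phi p u (R u)) (at (?s u) within ?s ` {u1..u0})"
      by (rule DERIV_subset)
    moreover have "(?s has_real_derivative - (1 / c)) (at u within {u1..u0})"
      using c by (auto intro!: derivative_eq_intros)
    ultimately have "(X \<circ> ?s has_real_derivative c * phi p u (R u) * - (1 / c)) (at u within {u1..u0})"
      by (rule DERIV_image_chain)
    then have "(X \<circ> ?s has_real_derivative - phi p u (R u)) (at u within {u1..u0})" using c by simp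
    then show ?thesis
      by (rule has_field_derivative_transform_within[OF _ zero_less_one]) (use u RA in auto)
  qed
  have derB: "(R has_real_derivative - phi p u (R u)) (at u within {u0..p})" if u: "u0 \<le> u" "u < p" for u
  proof -
    define t where "t = u / p - 1"
    have t: "- e \<le> t" "t < 0" using tB[OF u] by (auto simp: t_def)
    have "ereal \<bar>t\<bar> \<le> ereal e" using t by simp
    then have "ereal \<bar>t\<bar> < fps_conv_radius W" using rad by (rule le_less_trans)
    from Rloc_ode[OF pp(4,2) this _ _ eq] t e
    obtain D where D: "(Rloc p W has_real_derivative D) (at t)"
      "(1 + t) * D * EE p (p * (1 + t)) (Rloc p W t) = - 2 * (1 + Rloc p W t) * NN p (p * (1 + t)) (Rloc p W t)"
      by auto
    have pt: "p * (1 + t) = u" using pp by (simp add: t_def)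
    have Ru: "R u = Rloc p W t" using RB u by (simp add: t_def)
    have E: "EE p u (R u) > 0" using EE_pos(2)[of u p "R u"] low[of u] u pp by auto
    have u0': "u > 0" using u pp u1_bounds by simp
    have "u * (D / p) * EE p u (R u) = - 2 * (1 + R u) * NN p u (R u)"
      using D(2) pp unfolding pt Ru[symmetric] by (simp add: t_def field_simps)
    then have Dp: "D / p = - phi p u (R u)"
      using u0' E pp unfolding phi_def by (simp add: divide_simps) (simp add: algebra_simps)
    have "((\<lambda>u. Rloc p W (u / p - 1)) has_real_derivative D * (1 / p)) (at u within {u0..p})"
      by (rule DERIV_chain2[where f = "Rloc p W" and g = "\<lambda>u. u / p - 1", OF D(1)[unfolded t_def]]) (use pp in \<open>auto intro!: derivative_eq_intros\<close>)
    then have "((\<lambda>u. Rloc p W (u / p - 1)) has_real_derivative - phi p u (R u)) (at u within {u0..p})"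
      using Dp by simp
    then show ?thesis
      by (rule has_field_derivative_transform_within[OF _ zero_less_one]) (use u RB in auto)
  qed
  show ?thesis
  proof (rule that[of R])
    show "R u = Rloc p W (u / p - 1)" if "p * (1 - e) \<le> u" for u using RB that by (simp add: u0_def)
    show "R u1 = X 1" using RA[of u1] pp c by (simp add: c_def u0_def)
    fix u assume u: "u1 \<le> u" "u < p"
    show "Rlow p u < R u" "R u \<le> R1" using low[OF u] up[OF u] .
    have "{u1..p} = {u1..u0} \<union> {u0..p}" using pp by auto
    moreover have "(R has_real_derivative - phi p u (R u)) (at u within {u1..u0} \<union> {u0..p})"
      by (rule has_field_derivative_within_Un) (use derA[of u] derB[of u] u in auto)
    ultimately show "(R has_real_derivative - phi p u (R u)) (at u within {u1..p})" by simp
  qed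
qed


section \<open>Solutions for p close to 1\<close>

text \<open>Left of the sonic point, the derivative of L R (1 + R) - (p - u) in the direction of
  decreasing u is L (1 + 2 R) \<open>phi\<close> - 1. The lemma thus says that the comparison curve
  is crossed upwards only.\<close>

lemma steep_near_one:
  assumes u: "u1 \<le> u" "u < p" "p < 1" and bb: "bb p \<le> u1 / 2"
    and L: "L > 0" "L\<^sup>2 = 4 * (1 - p)" and R: "R > 0" "Rlow p u \<le> R" and eq: "p - u = L * (R * (1 + R))"
  shows "L * (1 + 2 * R) * phi p u R > 1"
proof -
  define D where "D = p - u"
  have pu: "0 < u" "0 < p" "u < 1" using u u1_bounds by auto
  note z = zb[OF pu(2) u(3)]
  have D: "D > 0" "D = L * (R * (1 + R))" using u eq by (auto simp: D_def)
  have E: "EE p u R > 0" by (rule EE_pos(2)) (use u R in auto)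
  have N: "NN p u R \<ge> R + m * D / 2"
  proof -
    have "1 / 2 \<le> (u - bb p) / u" using bb u pu by (simp add: field_simps)
    then have "m * D * (1 / 2) \<le> m * D * ((u - bb p) / u)" using m_bounds D by (intro mult_left_mono) auto
    also have "\<dots> = 1 * (- qq p u)" using pu by (simp add: qq_def D_def field_simps)
    also have "\<dots> \<le> (g + 1) / 2 * (- qq p u)"
    proof (intro mult_right_mono)
      have "(p - u) * (u - bb p) \<ge> 0" using bb u pu by auto
      then show "- qq p u \<ge> 0" using pu m_bounds by (auto simp: qq_def divide_le_0_iff mult_le_0_iff zero_le_mult_iff)
    qed (use g1 in auto)
    finally have "m * D / 2 \<le> - ((g + 1) / 2 * qq p u)" by simp
    moreover have "R \<le> hh p u * R" using hh_ge[OF pu(2) u(3)] u R by simp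
    ultimately show ?thesis by (simp add: NN_def)
  qed
  have uE: "u * EE p u R \<le> (m + 1) * (D + (1 - p)) * R + m * D"
  proof -
    have "kk p u \<le> (m + 1) * (1 - u)" using z m_bounds by (simp add: kk_def)
    then have "kk p u * R \<le> (m + 1) * (D + (1 - p)) * R" using R by (intro mult_right_mono) (auto simp: D_def)
    moreover have "u * (kk p u * R) \<le> 1 * (kk p u * R)"
      using pu R kk_ge[OF pu(2) u(3), of u] u by (intro mult_right_mono) auto
    moreover have "- (u * qq p u) \<le> m * D"
    proof -
      have "u * qq p u = m * (u - p) * (u - bb p)" using pu by (simp add: qq_def)
      then have "- (u * qq p u) = m * D * (u - bb p)" by (simp add: D_def algebra_simps)
      also have "\<dots> \<le> m * D * 1" using m_bounds D z pu by (intro mult_left_mono) auto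
      finally show ?thesis by simp
    qed
    ultimately show ?thesis by (simp add: EE_def algebra_simps)
  qed
  \<comment> \<open>After inserting D = L R (1 + R) three groups compare separately: m D \<le> 2 D,
    (m + 1) R D \<le> 4 R D, and (m + 1) (1 - p) R < m L^2 R = 4 m (1 - p) R. The last one motivates
    the choice of L.\<close>
  have main: "(m + 1) * (D + (1 - p)) * R + m * D < 2 * L * (1 + 2 * R) * (1 + R) * (R + m * D / 2)"
  proof -
    have "2 * L * (1 + 2 * R) * (1 + R) * (R + m * D / 2) = 2 * D + 4 * R * D + m * L\<^sup>2 * (R * ((1 + R) * ((1 + 2 * R) * (1 + R))))"
      unfolding D(2) by (simp add: field_simps power2_eq_square)
    moreover have "m * L\<^sup>2 * (R * 1) \<le> m * L\<^sup>2 * (R * ((1 + R) * ((1 + 2 * R) * (1 + R))))"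
    proof (intro mult_left_mono)
      have "1 * (1 * 1) \<le> (1 + R) * ((1 + 2 * R) * (1 + R))" using R by (intro mult_mono) auto
      then show "1 \<le> (1 + R) * ((1 + 2 * R) * (1 + R))" by simp
    qed (use R m_bounds in auto)
    moreover have "m * L\<^sup>2 * (R * 1) = 4 * m * ((1 - p) * R)" using L by simp
    moreover have "(m + 1) * ((1 - p) * R) < 4 * m * ((1 - p) * R)"
      using m_bounds u R by (intro mult_strict_right_mono) auto
    moreover have "m * D \<le> 2 * D" using m_bounds D by (intro mult_right_mono) auto
    moreover have "(m + 1) * (R * D) \<le> 4 * (R * D)" using m_bounds D R by (intro mult_right_mono) auto
    ultimately show ?thesis by (simp add: algebra_simps)
  qed
  also have "\<dots> \<le> 2 * L * (1 + 2 * R) * (1 + R) * NN p u R"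
    using N L R by (intro mult_left_mono) auto
  finally have "u * EE p u R < 2 * L * (1 + 2 * R) * (1 + R) * NN p u R" using uE by simp
  then have "1 < 2 * L * (1 + 2 * R) * (1 + R) * NN p u R / (u * EE p u R)" using pu E by simp
  also have "\<dots> = L * (1 + 2 * R) * phi p u R" by (simp add: phi_def)
  finally show ?thesis .
qed

lemma overshoot_point:
  obtains b L where "u1 < b" "b < 1" "L > 0" "L\<^sup>2 = 4 * (1 - b)" "bb b \<le> u1 / 2" "ss b < - 1 / L"
    "L * (R1 * (1 + R1)) \<le> b - u1"
proof -
  \<comment> \<open>The bound \<open>u1\<close> / 6 yields \<open>bb b\<close> \<le> 3 E \<le>
    \<open>u1\<close> / 2; the other one yields L R1 (1 + R1) \<le> 1/4 \<le> b -
    \<open>u1\<close>.\<close>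
  define E where "E = min (u1 / 6) ((1 / (8 * (R1 * (1 + R1))))\<^sup>2)"
  define b where "b = 1 - E"
  define L where "L = 2 * sqrt E"
  have RR: "R1 * (1 + R1) > 0" using R1_pos by simp
  have E: "0 < E" "E \<le> u1 / 6" "E \<le> 1 / 12" using u1_bounds RR by (auto simp: E_def)
  have b: "u1 < b" "b < 1" "0 < b" "1 / 4 \<le> b - u1" using E u1_bounds by (auto simp: b_def)
  have L: "L > 0" "L\<^sup>2 = 4 * (1 - b)" using E by (auto simp: L_def b_def power_mult_distrib)
  note z = zb[OF b(3,2)]
  have bb: "bb b \<le> u1 / 2"
  proof -
    have den: "1 \<le> g - (g - 2) * b"
    proof -
      have eq: "g - (g - 2) * b = g * E + 2 * (1 - E)" by (simp add: b_def algebra_simps)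
      have "0 < g * E" using E g1 by simp
      then have "1 \<le> g * E + 2 * (1 - E)" using E(3) by (simp add: algebra_simps)
      then show ?thesis unfolding eq .
    qed
    have "g * (1 - b) / (g - (g - 2) * b) \<le> 3 * E / 1"
      using g3 g1 E den by (intro frac_le mult_mono) (auto simp: b_def)
    then have "bb b \<le> 3 * E" by (simp add: bb_def)
    then show ?thesis using E by linarith
  qed
  \<comment> \<open>By \<open>ss_less\<close> this puts \<open>ss b\<close> below -1 / L. The
    quadratic term is at most 3/4, the linear one at most 0, and the constant term at most
    -1.\<close>
  have "TT b (- 1 / L) < 0"
  proof -
    have k: "kk b b \<le> 3 * E"
    proof -
      have "kk b b \<le> (m + 1) * E" using z m_bounds by (simp add: kk_def b_def)
      also have "\<dots> \<le> 3 * E" using m_bounds E by (intro mult_right_mono) auto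
      finally show ?thesis .
    qed
    have "kk b b * (- 1 / L)\<^sup>2 = kk b b / (4 * E)" using L by (simp add: power_divide b_def)
    also have "\<dots> \<le> 3 / 4" using k E by (simp add: divide_le_eq)
    finally have 1: "kk b b * (- 1 / L)\<^sup>2 \<le> 3 / 4" .
    have d: "1 / 2 \<le> b - bb b" using bb u1_bounds b E by (simp add: b_def)
    have "m * (b - bb b) \<le> 2 * 1" using m_bounds z b d by (intro mult_mono) auto
    then have "2 * hh b b - m * (b - bb b) \<ge> 0" using hh_ge[OF b(3,2) order_refl] by simp
    then have 2: "(2 * hh b b - m * (b - bb b)) * (- 1 / L) \<le> 0" using L by (simp add: divide_nonneg_pos)
    have "2 * 1 * (1 / 2) \<le> (g + 1) * m * (b - bb b)"
      using g1 m_bounds d by (intro mult_mono) auto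
    with 1 2 show ?thesis by (simp add: TT_def)
  qed
  then have s: "ss b < - 1 / L" using b by (intro ss_less) auto
  have "sqrt E \<le> 1 / (8 * (R1 * (1 + R1)))"
    by (rule real_le_lsqrt) (use RR in \<open>auto simp: E_def\<close>)
  then have "L * (R1 * (1 + R1)) \<le> 1 / 4" using RR by (simp add: L_def field_simps)
  then have "L * (R1 * (1 + R1)) \<le> b - u1" using b by simp
  then show ?thesis using that b(1,2) L bb s by blast
qed

text \<open>The solution starts above the comparison curve because its slope is steeper than -1 / L,
  and it stays above down to \<open>u1\<close>. There the curve has already reached at least
  R1.\<close>

lemma overshoot:
  assumes b: "u1 < b" "b < 1" and L: "L > 0" "L\<^sup>2 = 4 * (1 - b)" and bb: "bb b \<le> u1 / 2" and s: "ss b < - 1 / L"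
    and LR: "L * (R1 * (1 + R1)) \<le> b - u1"
    and rad: "fps_conv_radius W > 0" and e: "e > 0"
    and loc: "\<And>u. b * (1 - e) \<le> u \<Longrightarrow> R u = Rloc b W (u / b - 1)"
    and low: "\<And>u. u1 \<le> u \<Longrightarrow> u < b \<Longrightarrow> Rlow b u < R u"
    and der: "\<And>u. u1 \<le> u \<Longrightarrow> u < b \<Longrightarrow> (R has_real_derivative - phi b u (R u)) (at u within {u1..b})"
  shows "R u1 > R1"
proof -
  have b0: "0 < b" using b u1_bounds by simp
  have Rpos: "R u > 0" if "u1 \<le> u" "u < b" for u
    using low[OF that] Rlow_nonneg[of u b] that u1_bounds by force
  define F where "F t = L * (Rloc b W t * (1 + Rloc b W t)) + b * t" for t
  have F0: "Rloc b W 0 = 0" by (simp add: Rloc_def)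
  have "(F has_real_derivative L * ss b + b) (at 0)"
    unfolding F_def[abs_def] using Rloc_deriv_0[OF rad, of b]
    by (auto intro!: derivative_eq_intros simp: F0)
  moreover have "L * ss b + b < 0"
    using mult_strict_left_mono[OF s L(1)] L b by simp
  ultimately obtain d where d: "d > 0" "\<And>h. 0 < h \<Longrightarrow> h < d \<Longrightarrow> F 0 < F (0 - h)"
    using DERIV_neg_dec_left by blast
  define h where "h = min (d / 2) (min e (1 - u1 / b))"
  have h: "0 < h" "h < d" "h \<le> e" "h \<le> 1 - u1 / b" using d e b b0 by (auto simp: h_def)
  define u2 where "u2 = b * (1 - h)"
  have u2: "u1 \<le> u2" "u2 < b" using h b0 by (auto simp: u2_def field_simps)
  define T where "T u = L * (R u * (1 + R u)) - (b - u)" for u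
  have T2: "T u2 > 0"
  proof -
    have "b * h \<le> b * e" using h b0 by (intro mult_left_mono) auto
    then have "R u2 = Rloc b W (u2 / b - 1)" using b0 by (intro loc) (simp add: u2_def algebra_simps)
    moreover have "u2 / b - 1 = - h" using b0 by (simp add: u2_def)
    ultimately have "R u2 = Rloc b W (- h)" by simp
    then have "T u2 = F (0 - h)" by (simp add: T_def F_def u2_def algebra_simps)
    also have "\<dots> > F 0" using d(2)[OF h(1,2)] .
    finally show ?thesis by (simp add: F_def Rloc_def)
  qed
  \<comment> \<open>The barrier argument moves to the right, hence the variable x = -u.\<close>
  have "T (- (- u1)) > 0"
  proof (rule barrier[of "- u2" "- u1" "\<lambda>x. T (- x)" "\<lambda>x. L * (1 + 2 * R (- x)) * phi b (- x) (R (- x)) - 1"])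
    fix x assume x: "x \<in> {- u2..- u1}"
    define u where "u = - x"
    have u: "u1 \<le> u" "u < b" using x u2 by (auto simp: u_def)
    have "(T has_real_derivative L * (- phi b u (R u) * (1 + R u) + (- phi b u (R u)) * R u) + 1) (at u within {u1..b})"
      unfolding T_def[abs_def] using der[OF u] by (auto intro!: derivative_eq_intros)
    moreover have "uminus ` {- u2..- u1} \<subseteq> {u1..b}" using u2 by auto
    ultimately have "(T has_real_derivative L * (- phi b u (R u) * (1 + R u) + (- phi b u (R u)) * R u) + 1) (at (- x) within uminus ` {- u2..- u1})"
      unfolding u_def by (rule DERIV_subset)
    moreover have "(uminus has_real_derivative - 1) (at x within {- u2..- u1})"
      by (auto intro!: derivative_eq_intros)
    ultimately have "(T \<circ> uminus has_real_derivative (L * (- phi b u (R u) * (1 + R u) + (- phi b u (R u)) * R u) + 1) * - 1) (at x within {- u2..- u1})"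
      by (rule DERIV_image_chain)
    then show "((\<lambda>x. T (- x)) has_real_derivative L * (1 + 2 * R (- x)) * phi b (- x) (R (- x)) - 1) (at x within {- u2..- u1})"
      by (simp add: o_def u_def algebra_simps)
    assume "T (- x) = 0"
    then have "b - u = L * (R u * (1 + R u))" by (simp add: T_def u_def)
    then show "L * (1 + 2 * R (- x)) * phi b (- x) (R (- x)) - 1 > 0"
      using steep_near_one[OF u b(2) bb L Rpos[OF u] less_imp_le[OF low[OF u]]] by (simp add: u_def)
  qed (use T2 u2 in auto)
  then have "L * (R u1 * (1 + R u1)) > L * (R1 * (1 + R1))" using LR by (simp add: T_def)
  then have lt: "R1 * (1 + R1) < R u1 * (1 + R u1)" using L by simp
  show ?thesis
  proof (rule ccontr)
    assume "\<not> R u1 > R1"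
    then have "R u1 * (1 + R u1) \<le> R1 * (1 + R1)"
      using Rpos[of u1] b R1_pos by (intro mult_mono) auto
    with lt show False by simp
  qed
qed

section \<open>The connecting parameter\<close>

lemma connecting_solution:
  obtains p e W R where "u1 < p" "p < 1" "0 < e" "ereal e < fps_conv_radius W" "R u1 = R1"
    "\<And>u. p * (1 - e) \<le> u \<Longrightarrow> R u = Rloc p W (u / p - 1)"
    "\<And>u. u1 \<le> u \<Longrightarrow> u < p \<Longrightarrow> Rlow p u < R u"
    "\<And>u. u1 \<le> u \<Longrightarrow> u < p \<Longrightarrow> (R has_real_derivative - phi p u (R u)) (at u within {u1..p})"
proof -
  obtain b L where b: "u1 < b" "b < 1" and L: "L > 0" "L\<^sup>2 = 4 * (1 - b)" "bb b \<le> u1 / 2" "ss b < - 1 / L"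
    "L * (R1 * (1 + R1)) \<le> b - u1" by (rule overshoot_point)
  obtain e W where e: "0 < e" "e < 1" "u1 < b * (1 - e)"
    and rad: "\<And>p. p \<in> {u1..b} \<Longrightarrow> ereal e < fps_conv_radius (W p)"
    and eq: "\<And>p. p \<in> {u1..b} \<Longrightarrow> sing_eq (poly_shift 1 (sP p)) (uP p) (vP p) (dP p) (cP p) (W p) = 0"
    and x0: "continuous_on {u1..b} (\<lambda>p. Rloc p (W p) (- e))"
    and loc1: "\<And>p t. p \<in> {u1..b} \<Longrightarrow> - e \<le> t \<Longrightarrow> t < 0 \<Longrightarrow> Rloc p (W p) t < R1"
    and loc2: "\<And>p t. p \<in> {u1..b} \<Longrightarrow> - e \<le> t \<Longrightarrow> t < 0 \<Longrightarrow> (1 + t)\<^sup>2 * (1 + Rloc p (W p) t) > 1"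
    by (rule local_family[OF b]) blast
  define a where "a = u1 / (1 - e)"
  have ab: "a \<le> b" using e by (simp add: a_def divide_le_eq)
  have ua: "u1 < a" using e u1_bounds by (simp add: a_def field_simps)
  obtain X where Xc: "continuous_on {a..b} (\<lambda>p. X p 1)"
    and X0: "\<And>p. p \<in> {a..b} \<Longrightarrow> X p 0 = Rloc p (W p) (- e)"
    and X: "\<And>p \<sigma>. p \<in> {a..b} \<Longrightarrow> \<sigma> \<in> {0..1} \<Longrightarrow>
       (X p has_real_derivative (p * (1 - e) - u1) * phi p (upt_of e p \<sigma>) (Rcl p (upt_of e p \<sigma>) (X p \<sigma>)))
         (at \<sigma> within {0..1})"
    unfolding a_def by (rule truncated_family[OF b e(1,2) less_imp_le[OF e(3)] x0]) blast
  \<comment> \<open>At p = a the starting point p (1 - e) is \<open>u1\<close> itself and the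
    solution does not move.\<close>
  have Xa: "X a 1 < R1"
  proof -
    have "(X a has_real_derivative 0) (at \<sigma> within {0..1})" if "\<sigma> \<in> {0..1}" for \<sigma>
      using X[of a \<sigma>] that ab e by (simp add: a_def)
    then have "X a 1 = X a 0"
      using has_field_derivative_zero_constant[of "{0..1::real}" "X a"] by force
    then show ?thesis using X0[of a] loc1[of a "- e"] ab ua e by simp
  qed
  have sol: "\<exists>R. (\<forall>u\<ge>p * (1 - e). R u = Rloc p (W p) (u / p - 1)) \<and> R u1 = X p 1 \<and>
      (\<forall>u. u1 \<le> u \<and> u < p \<longrightarrow> Rlow p u < R u \<and> (R has_real_derivative - phi p u (R u)) (at u within {u1..p}))"
    if p: "a < p" "p \<le> b" and X1: "X p 1 \<le> R1" for p
  proof -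
    have p': "p \<in> {a..b}" "p \<in> {u1..b}" "u1 / (1 - e) < p" "p < 1" using p ua b by (auto simp: a_def)
    show ?thesis
      by (rule global_solution[OF e(1,2) p'(3,4) X[OF p'(1)] X0[OF p'(1)] X1 rad[OF p'(2)] eq[OF p'(2)]
            loc1[OF p'(2)] loc2[OF p'(2)]]) blast+
  qed
  \<comment> \<open>Overshooting is known for genuine solutions. If the clamped one ended at or
    below R1, its clamps would be inactive and it would be genuine.\<close>
  have Xb: "X b 1 > R1"
  proof (rule ccontr)
    assume "\<not> X b 1 > R1"
    then have le: "X b 1 \<le> R1" by simp
    have "a < b" using e by (simp add: a_def divide_less_eq)
    from sol[OF this order_refl le] obtain R where R: "\<And>u. u \<ge> b * (1 - e) \<Longrightarrow> R u = Rloc b (W b) (u / b - 1)"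
      "R u1 = X b 1" "\<And>u. u1 \<le> u \<Longrightarrow> u < b \<Longrightarrow> Rlow b u < R u"
      "\<And>u. u1 \<le> u \<Longrightarrow> u < b \<Longrightarrow> (R has_real_derivative - phi b u (R u)) (at u within {u1..b})" by blast
    have "fps_conv_radius (W b) > 0" using rad[of b] b e
      by (metis atLeastAtMost_iff ereal_less(2) less_imp_le less_trans order_refl)
    from overshoot[OF b L this e(1) R(1,3,4)] R(2) le show False by simp
  qed
  have "\<exists>p\<ge>a. p \<le> b \<and> X p 1 = R1"
    using Xa Xb Xc ab by (intro IVT') auto
  then obtain p where p: "a \<le> p" "p \<le> b" "X p 1 = R1" by blast
  then have "a < p" using Xa by (cases "a = p") auto
  from sol[OF this p(2)] p(3) obtain R where R: "\<And>u. u \<ge> p * (1 - e) \<Longrightarrow> R u = Rloc p (W p) (u / p - 1)"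
      "R u1 = R1" "\<And>u. u1 \<le> u \<Longrightarrow> u < p \<Longrightarrow> Rlow p u < R u"
      "\<And>u. u1 \<le> u \<Longrightarrow> u < p \<Longrightarrow> (R has_real_derivative - phi p u (R u)) (at u within {u1..p})" by auto
  show ?thesis
    by (rule that[of p e "W p" R]) (use R rad p ua \<open>a < p\<close> b e in auto)
qed


section \<open>Return to the variables V, C and z\<close>

lemma u_qq: "0 < p \<Longrightarrow> p < 1 \<Longrightarrow> 0 < u \<Longrightarrow> u * qq p u = m * (u\<^sup>2 - u * (1 + (g - 2) * zz p) + g * zz p)"
proof -
  assume p: "0 < p" "p < 1" and u: "0 < u"
  have "u * qq p u = m * ((u - p) * (u - bb p))" using u by (simp add: qq_def)
  also have "(u - p) * (u - bb p) = u\<^sup>2 - u * (1 + (g - 2) * zz p) + g * zz p"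
    using zb(4,5)[OF p] by algebra
  finally show ?thesis .
qed

lemma Gf_eq:
  assumes "0 < p" "p < 1" "0 < u" "C\<^sup>2 = u\<^sup>2 * (1 + R)"
  shows "Gf m g (zz p) (u - 1) C = - (u\<^sup>2) * EE p u R"
  using u_qq[OF assms(1-3)] assms(4) unfolding Gf_def lam_def EE_def kk_def
  by (simp add: power2_eq_square) algebra

lemma Ff_eq:
  assumes "0 < p" "p < 1" "0 < u" "C\<^sup>2 = u\<^sup>2 * (1 + R)"
  shows "Ff m g (zz p) (u - 1) C = C * u * (NN p u R - EE p u R)"
proof -
  have 1: "C\<^sup>2 * (1 + m * zz p / (1 + (u - 1))) = (1 + R) * (u\<^sup>2 + m * zz p * u)"
    using assms by (simp add: field_simps power2_eq_square)
  have "u * (NN p u R - EE p u R) = u * R * (u + m * zz p) - (g - 1) / 2 * (u * qq p u)"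
    by (simp add: NN_def EE_def hh_def kk_def field_simps)
  also have "\<dots> = (1 + R) * (u\<^sup>2 + m * zz p * u) - a1 m g * (1 + (u - 1))\<^sup>2 + a2 m g (zz p) * (1 + (u - 1)) - a3 m g (zz p)"
    unfolding u_qq[OF assms(1-3)] a1_def a2_def a3_def by (simp add: field_simps power2_eq_square)
  finally show ?thesis unfolding Ff_def 1 by (simp add: mult.assoc)
qed

text \<open>Differentiating C = u sqrt (1 + R) at the sonic point, with dR/du = s / p, gives c = 1 +
  s / 2.\<close>

lemma slope_quad_eq:
  assumes p: "0 < p" "p < 1"
  shows "slope_quad m g (zz p) (p - 1) p c = p / 2 * TT p (2 * (c - 1))"
proof -
  let ?z = "zz p"
  have GC: "deriv (\<lambda>C. Gf m g ?z (p - 1) C) p = 2 * p * ((m + 1) * (p - 1) + 2 * m * ?z)"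
    by (rule DERIV_imp_deriv) (auto simp: Gf_def intro!: derivative_eq_intros)
  have FC: "deriv (\<lambda>C. Ff m g ?z (p - 1) C) p =
     3 * p\<^sup>2 * (1 + m * ?z / p) - a1 m g * p\<^sup>2 + a2 m g ?z * p - a3 m g ?z"
    by (rule DERIV_imp_deriv) (auto simp: Ff_def power2_eq_square algebra_simps intro!: derivative_eq_intros)
  have GV: "deriv (\<lambda>V. Gf m g ?z V p) (p - 1) = p\<^sup>2 * (m + 1) - (p * (lam m g ?z + (p - 1)) + (p - 1) * (lam m g ?z + (p - 1)) + (p - 1) * p)"
    by (rule DERIV_imp_deriv) (auto simp: Gf_def algebra_simps intro!: derivative_eq_intros)
  have FV: "deriv (\<lambda>V. Ff m g ?z V p) (p - 1) = p * (p\<^sup>2 * (- (m * ?z / p\<^sup>2)) - a1 m g * (2 * p) + a2 m g ?z)"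
    by (rule DERIV_imp_deriv) (use p in \<open>auto simp: Ff_def power2_eq_square algebra_simps intro!: derivative_eq_intros\<close>)
  have d: "p * (p - bb p) = p\<^sup>2 - g * ?z" "bb p = 1 + (g - 2) * ?z - p"
    using zb(4,5)[OF p] by (auto simp: algebra_simps power2_eq_square)
  have q: "p\<^sup>2 - p * (1 + (g - 2) * ?z) + g * ?z = 0" using zb(4,5)[OF p] by algebra
  have z1: "3 * p\<^sup>2 * (1 + m * ?z / p) = 3 * p\<^sup>2 + 3 * p * m * ?z"
    using p by (simp add: field_simps power2_eq_square)
  have z2: "p\<^sup>2 * (- (m * ?z / p\<^sup>2)) = - m * ?z" using p by simp
  show ?thesis unfolding slope_quad_def GC FC GV FV TT_def z1 z2 kk_def hh_def lam_def a1_def a2_def a3_def d(2)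
    using q by (simp add: field_simps power2_eq_square) algebra
qed

text \<open>C^2 = p^2 (1 + t)^2 (1 + R) is a power series in t with constant term p^2 > 0, so its
  root is analytic. Passing from t to x = p t divides the n-th coefficient by p^n.\<close>

lemma C_powser:
  assumes p: "u1 < p" "p < 1" and e: "0 < e" and rad: "ereal e < fps_conv_radius W"
    and loc: "\<And>u. p * (1 - e) \<le> u \<Longrightarrow> R u = Rloc p W (u / p - 1)"
  shows "\<exists>a r. r > 0 \<and> (\<forall>x. - r < x \<and> x \<le> 0 \<longrightarrow> (\<lambda>n. a n * x ^ n) sums ((p + x) * sqrt (1 + R (p + x))))
      \<and> a 0 = p \<and> a 1 = 1 + ss p / 2"
proof -
  define f where "f = fps_of_poly [:p\<^sup>2, 2 * p\<^sup>2, p\<^sup>2:] * (1 + fps_X * (fps_const (ss p) + fps_X * W))"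
  have p0: "p > 0" using p u1_bounds by simp
  have ev: "eval_fps f t = p\<^sup>2 * (1 + t)\<^sup>2 * (1 + Rloc p W t)" "ereal \<bar>t\<bar> < fps_conv_radius f"
    if t: "\<bar>t\<bar> \<le> e" for t
  proof -
    have m: "ereal (norm t) < fps_conv_radius (f * h)" "eval_fps (f * h) t = eval_fps f t * eval_fps h t"
      if "norm t < fps_conv_radius f" "norm t < fps_conv_radius h" for f h :: "real fps"
      using that fps_conv_radius_mult[of f h] eval_fps_mult[of t f h] by (auto simp: min_def split: if_splits)
    have a: "ereal (norm t) < fps_conv_radius (f + h)" "eval_fps (f + h) t = eval_fps f t + eval_fps h t"
      if "norm t < fps_conv_radius f" "norm t < fps_conv_radius h" for f h :: "real fps"
      using that fps_conv_radius_add[of f h] eval_fps_add[of t f h] by (auto simp: min_def split: if_splits)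
    have i: "ereal (norm t) < fps_conv_radius (fps_of_poly q)" "ereal (norm t) < fps_conv_radius (fps_X :: real fps)"
      "ereal (norm t) < fps_conv_radius (1 :: real fps)" "ereal (norm t) < fps_conv_radius (fps_const c)" for q :: "real poly" and c :: real
      by auto
    have W: "ereal (norm t) < fps_conv_radius W"
      by (rule le_less_trans[OF _ rad]) (use t in simp)
    have "eval_fps f t = poly [:p\<^sup>2, 2 * p\<^sup>2, p\<^sup>2:] t * (1 + t * (ss p + t * eval_fps W t))"
      unfolding f_def by (simp only: a m i W eval_fps_of_poly eval_fps_X eval_fps_1 eval_fps_const)
    then show "eval_fps f t = p\<^sup>2 * (1 + t)\<^sup>2 * (1 + Rloc p W t)"
      by (simp add: Rloc_def power2_eq_square algebra_simps)
    show "ereal \<bar>t\<bar> < fps_conv_radius f"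
      unfolding f_def real_norm_def[symmetric] by (intro a m i W)
  qed
  have rf: "fps_conv_radius f > 0" using ev(2)[of 0] e by (simp add: zero_ereal_def)
  have f0: "fps_nth f 0 = p\<^sup>2" by (simp add: f_def)
  have f1: "fps_nth f 1 = p\<^sup>2 * (2 + ss p)" by (simp add: f_def fps_mult_nth algebra_simps)
  obtain h r where r: "r > 0" and h: "\<And>x. \<bar>x\<bar> < r \<Longrightarrow> (\<lambda>n. h n * x ^ n) sums sqrt (eval_fps f x)"
    and h01: "h 0 = sqrt (fps_nth f 0)" "h 1 = fps_nth f 1 / (2 * sqrt (fps_nth f 0))"
    using sqrt_eval_fps_powser[OF rf] f0 p0 by (metis zero_less_power)
  define a where "a n = h n / p ^ n" for n
  \<comment> \<open>The bound e keeps x where R is given by the series; the bound 1 keeps 1 + t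
    positive, so that it is the root of its square.\<close>
  define r' where "r' = p * min r (min e 1)"
  show ?thesis
  proof (intro exI[of _ a] exI[of _ r'] conjI allI impI)
    show "r' > 0" using p0 r e by (simp add: r'_def)
    show "a 0 = p" using p0 h01 f0 by (simp add: a_def)
    have "h 1 = p * (1 + ss p / 2)" unfolding h01 f0 f1 using p0 by (simp add: power2_eq_square field_simps)
    then show "a 1 = 1 + ss p / 2" using p0 by (simp add: a_def)
    fix x assume x: "- r' < x \<and> x \<le> 0"
    define t where "t = x / p"
    have px: "x = p * t" using p0 by (simp add: t_def)
    have "p * (- min r (min e 1)) < p * t" using x by (simp add: px r'_def)
    then have t: "- min r (min e 1) < t" "t \<le> 0"
      using p0 x by (simp_all only: mult_less_cancel_left_pos) (simp add: t_def divide_nonpos_pos)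
    have t': "\<bar>t\<bar> < r" "\<bar>t\<bar> \<le> e" "0 < 1 + t" using t by auto
    have "p * (- t) \<le> p * e" using t' p0 by (intro mult_left_mono) auto
    then have "p * (1 - e) \<le> p + x" unfolding px by (simp add: algebra_simps)
    then have R: "R (p + x) = Rloc p W t" using loc[of "p + x"] p0 by (simp add: px field_simps)
    have "sqrt (eval_fps f t) = p * (1 + t) * sqrt (1 + R (p + x))"
      using t' p0 by (simp add: ev(1)[OF t'(2)] R real_sqrt_mult)
    moreover have "p * (1 + t) = p + x" by (simp add: px algebra_simps)
    moreover have "a n * x ^ n = h n * t ^ n" for n using p0 by (simp add: a_def px power_mult_distrib)
    ultimately show "(\<lambda>n. a n * x ^ n) sums ((p + x) * sqrt (1 + R (p + x)))"
      using h[OF t'(1)] by simp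
  qed
qed

lemma connecting_Csol:
  obtains p C where "u1 < p" "p < 1" "Csol m g (zz p) (p - 1) p C" "C (V1 g) = C1 g"
proof -
  obtain p e W R where p: "u1 < p" "p < 1" and e: "0 < e" "ereal e < fps_conv_radius W" and R1: "R u1 = R1"
    and loc: "\<And>u. p * (1 - e) \<le> u \<Longrightarrow> R u = Rloc p W (u / p - 1)"
    and low: "\<And>u. u1 \<le> u \<Longrightarrow> u < p \<Longrightarrow> Rlow p u < R u"
    and der: "\<And>u. u1 \<le> u \<Longrightarrow> u < p \<Longrightarrow> (R has_real_derivative - phi p u (R u)) (at u within {u1..p})"
    by (rule connecting_solution) blast
  define C where "C V = (1 + V) * sqrt (1 + R (1 + V))" for V
  have p0: "0 < p" "u1 \<le> p" using p u1_bounds by auto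
  have V1: "V1 g = u1 - 1" using g1 by (simp add: V1_def u1_def field_simps)
  have R0: "0 \<le> R u" if "u1 \<le> u" "u \<le> p" for u
  proof (cases "u = p")
    case True
    have "R p = Rloc p W 0" using loc[of p] p0 e by simp
    then show ?thesis using True by (simp add: Rloc_def)
  next
    case False
    then show ?thesis using low[of u] Rlow_nonneg[of u p] that u1_bounds by force
  qed
  have ode: "Gf m g (zz p) V (C V) \<noteq> 0 \<and>
     (C has_real_derivative (Ff m g (zz p) V (C V) / Gf m g (zz p) V (C V))) (at V within {V1 g..p - 1})"
    if V: "V \<in> {V1 g..<p - 1}" for V
  proof -
    define u where "u = 1 + V"
    have u: "u1 \<le> u" "u < p" "0 < u" and Vu: "V = u - 1" using V u1_bounds by (auto simp: u_def V1)
    have R: "0 \<le> R u" using R0 u by simp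
    have E: "EE p u (R u) > 0" using EE_pos(2)[OF u(1,2) p(2) less_imp_le[OF low[OF u(1,2)]]] .
    have C2: "(C V)\<^sup>2 = u\<^sup>2 * (1 + R u)" using R by (simp add: C_def power_mult_distrib flip: u_def)
    have C: "C V = u * sqrt (1 + R u)" by (simp add: C_def u_def)
    have G: "Gf m g (zz p) V (C V) = - (u\<^sup>2) * EE p u (R u)" unfolding Vu by (rule Gf_eq) (use p0 p u C2 Vu in auto)
    have F: "Ff m g (zz p) V (C V) = C V * u * (NN p u (R u) - EE p u (R u))" unfolding Vu by (rule Ff_eq) (use p0 p u C2 Vu in auto)
    have "(+) 1 ` {V1 g..p - 1} \<subseteq> {u1..p}" by (auto simp: V1)
    with der[OF u(1,2)] have "(R has_real_derivative - phi p u (R u)) (at (1 + V) within (+) 1 ` {V1 g..p - 1})"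
      unfolding u_def by (rule DERIV_subset)
    moreover have "((+) 1 has_real_derivative 1) (at V within {V1 g..p - 1})" by (auto intro!: derivative_eq_intros)
    ultimately have "(R \<circ> (+) 1 has_real_derivative - phi p u (R u) * 1) (at V within {V1 g..p - 1})"
      by (rule DERIV_image_chain)
    then have dR: "((\<lambda>V. R (1 + V)) has_real_derivative - phi p u (R u)) (at V within {V1 g..p - 1})" by (simp add: o_def)
    have dC: "(C has_real_derivative sqrt (1 + R u) + u * (- phi p u (R u) / (2 * sqrt (1 + R u)))) (at V within {V1 g..p - 1})"
    proof -
      have sq: "sqrt (1 + R u) * (sqrt (1 + R u) * y) = (1 + R u) * y" for y
        using R by (simp flip: mult.assoc)
      then show ?thesis unfolding C_def[abs_def] using dR R
        by (auto intro!: derivative_eq_intros simp: u_def sq[unfolded u_def] field_simps)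
    qed
    \<comment> \<open>Logarithmic differentiation: C' / C = 1 / u + R' / (2 (1 + R)) = (1 -
      \<open>NN\<close> / \<open>EE\<close>) / u.\<close>
    have "sqrt (1 + R u) + u * (- phi p u (R u) / (2 * sqrt (1 + R u))) = sqrt (1 + R u) * (1 - NN p u (R u) / EE p u (R u))"
    proof -
      have s: "sqrt (1 + R u) > 0" "1 + R u = sqrt (1 + R u) * sqrt (1 + R u)" using R by auto
      have "u * (phi p u (R u) / (2 * sqrt (1 + R u))) = (1 + R u) / sqrt (1 + R u) * (NN p u (R u) / EE p u (R u))"
        using u by (simp add: phi_def)
      also have "(1 + R u) / sqrt (1 + R u) = sqrt (1 + R u)" using s by (simp add: real_div_sqrt R)
      finally show ?thesis by (simp add: right_diff_distrib)
    qed
    also have "\<dots> = Ff m g (zz p) V (C V) / Gf m g (zz p) V (C V)"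
      unfolding G F unfolding C using u E by (simp add: divide_simps power2_eq_square) (simp add: algebra_simps)
    finally show ?thesis using dC G u E by simp
  qed
  obtain a r where ar: "r > 0" "\<And>x. - r < x \<Longrightarrow> x \<le> 0 \<Longrightarrow> (\<lambda>n. a n * x ^ n) sums ((p + x) * sqrt (1 + R (p + x)))"
    "a 0 = p" "a 1 = 1 + ss p / 2"
    using C_powser[OF p e loc] by blast
  have "Csol m g (zz p) (p - 1) p C"
    unfolding Csol_def
  proof (intro conjI exI[of _ a] exI[of _ r] ballI allI impI)
    show "V1 g < p - 1" using p by (simp add: V1)
    show "r > 0" by (rule ar)
    show "a 0 = p" by (rule ar)
    show "a 1 < 0" using ss_less_neg2[OF p0(2) p(2) p0(2) p(2)] ar by simp
    show "slope_quad m g (zz p) (p - 1) p (a 1) = 0"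
      unfolding ar(4) slope_quad_eq[OF p0(1) p(2)] using TT_ss[OF p0(2) p(2)] by simp
    fix c assume c: "c < 0 \<and> slope_quad m g (zz p) (p - 1) p c = 0"
    then have "TT p (2 * (c - 1)) = 0" using slope_quad_eq[OF p0(1) p(2), of c] p0 by simp
    then have "2 * (c - 1) = ss p" by (rule TT_root_unique[OF p0(2) p(2)]) (use c in simp)
    then show "c = a 1" unfolding ar(4) by simp
  next
    fix V assume "p - 1 - r < V \<and> V \<le> p - 1"
    then show "(\<lambda>n. a n * (V - (p - 1)) ^ n) sums C V"
      using ar(2)[of "V - (p - 1)"] by (simp add: C_def algebra_simps)
  next
    fix V assume V: "V \<in> {V1 g..p - 1}"
    then have "0 \<le> R (1 + V)" "0 < 1 + V" using R0[of "1 + V"] u1_bounds by (auto simp: V1)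
    then show "C V > 0" by (simp add: C_def)
  qed (use ode in auto)
  moreover have "C (V1 g) = C1 g"
  proof -
    have "C (V1 g) = u1 * sqrt (1 + R1)" by (simp add: C_def V1 R1)
    also have "1 + R1 = 2 * g * (g - 1) / (g - 1)\<^sup>2"
      using g1 by (simp add: R1_def power2_eq_square add_divide_eq_iff)
    also have "u1 * sqrt \<dots> = C1 g" using g1 by (simp add: C1_def u1_def real_sqrt_divide)
    finally show ?thesis .
  qed
  ultimately show ?thesis using that p by blast
qed

text \<open>The square root in V6 and V8 is |p - \<open>bb p\<close>|, so the smaller root belongs
  to P6 and the larger one to P8. The lower end \<open>zm g\<close> is the value of
  \<open>zz\<close> at \<open>u1\<close>.\<close>

lemma Pstar_zz:
  assumes "u1 < p" "p < 1"
  defines "k \<equiv> if p \<le> bb p then 6 else 8 :: nat"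
  shows "k \<in> {6, 8}" "zz p \<in> Zset k g" "Pstar k g (zz p) = (p - 1, p)"
proof -
  have p: "0 < p" "p < 1" using assms u1_bounds by auto
  note z = zb[OF p]
  show "k \<in> {6, 8}" by (simp add: k_def)
  have disc: "1 - 2 * (g + 2) * zz p + (g - 2)\<^sup>2 * (zz p)\<^sup>2 = (p - bb p)\<^sup>2"
    using z(4,5) by algebra
  have w: "wf g (zz p) = \<bar>p - bb p\<bar>" unfolding wf_def disc by simp
  show "Pstar k g (zz p) = (p - 1, p)"
  proof -
    have "(g - 2) * zz p = p + bb p - 1" using z(5) by simp
    then show ?thesis unfolding Pstar_def P6_def P8_def V6_def V8_def w k_def by (auto simp: abs_if diff_divide_distrib add_divide_distrib)
  qed
  have zM: "zz p \<le> zM g"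
  proof -
    \<comment> \<open>Nonnegativity of the discriminant, arranged as a comparison of two squares;
      roots can be taken because (g + 2) z < 1.\<close>
    have "8 * g * (zz p)\<^sup>2 \<le> (1 - (g + 2) * zz p)\<^sup>2"
    proof -
      have "(1 - (g + 2) * zz p)\<^sup>2 - 8 * g * (zz p)\<^sup>2 = (p - bb p)\<^sup>2"
        unfolding disc[symmetric] by (simp add: power2_eq_square algebra_simps)
      then show ?thesis by (smt (verit) zero_le_power2)
    qed
    then have "(2 * sqrt (2 * g) * zz p)\<^sup>2 \<le> (1 - (g + 2) * zz p)\<^sup>2" using g1 by (simp add: power_mult_distrib)
    then have "2 * sqrt (2 * g) * zz p \<le> 1 - (g + 2) * zz p"
      by (rule power2_le_imp_le) (use z in simp)
    moreover have "(sqrt g + sqrt 2)\<^sup>2 = g + 2 + 2 * sqrt (2 * g)"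
      using g1 by (simp add: power2_sum real_sqrt_mult)
    ultimately have "zz p * (sqrt g + sqrt 2)\<^sup>2 \<le> 1" by (simp add: algebra_simps)
    moreover have "(sqrt g + sqrt 2)\<^sup>2 > 0" using g1 by (intro zero_less_power add_pos_pos) auto
    ultimately show ?thesis by (simp add: zM_def le_divide_eq)
  qed
  have zm: "zm g \<le> zz p" if "p \<le> bb p"
  proof -
    \<comment> \<open>In the case of P6 both roots lie to the right of \<open>u1\<close>. The
      product is affine in z and vanishes at z = \<open>zm g\<close>.\<close>
    have "(p - u1) * (bb p - u1) \<ge> 0" using that assms by simp
    moreover have "(p - u1) * (bb p - u1) = zz p * (g - (g - 2) * u1) - u1 * (1 - u1)"
      using z(4,5) by algebra
    moreover have "zz p * (g - (g - 2) * u1) - u1 * (1 - u1) = (zz p * ((2 * g - 1) * (g + 1)) - (g - 1)) * (2 / (g + 1)\<^sup>2)"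
      using g1 by (simp add: u1_def divide_simps) (simp add: algebra_simps power2_eq_square)
    ultimately have "0 \<le> (zz p * ((2 * g - 1) * (g + 1)) - (g - 1)) * (2 / (g + 1)\<^sup>2)" by linarith
    moreover have "2 / (g + 1)\<^sup>2 > 0" using g1 by simp
    ultimately have "zz p * ((2 * g - 1) * (g + 1)) - (g - 1) \<ge> 0" by (simp only: zero_le_mult_iff) linarith
    then show ?thesis using g1 by (simp add: zm_def divide_le_eq)
  qed
  show "zz p \<in> Zset k g" using z zM zm by (auto simp: Zset_def k_def)
qed

end

theorem mainTheorem6:
  fixes g :: real and m :: nat
  assumes "1 < g" and "g \<le> 3" and "m \<in> {1, 2}"
  shows "\<exists>k \<in> {6::nat, 8}. \<exists>z \<in> Zset k g. \<exists>C.
           Csol (real m) g z (fst (Pstar k g z)) (snd (Pstar k g z)) C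
           \<and> C (V1 g) = C1 g"
proof -
  interpret shock "real m" g
    by unfold_locales (use assms in auto)
  obtain p C where p: "u1 < p" "p < 1" and C: "Csol (real m) g (zz p) (p - 1) p C" "C (V1 g) = C1 g"
    by (rule connecting_Csol)
  show ?thesis
    by (intro bexI[OF _ Pstar_zz(1)[OF p]] bexI[OF _ Pstar_zz(2)[OF p]] exI[of _ C])
       (unfold Pstar_zz(3)[OF p], use C in simp)
qed

end
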